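(* For every $\epsilon>0$ there is a deterministic polynomial-time algorithm for online $2$-level $f$-partial group Steiner tree on weighted trees which is $\frac{1}{\epsilon}\cdot\max_i\frac{n_i}{f_i}$-cost-competitive and $(1-\epsilon)$-connection-competitive.
   Context: Online $2$-level $f$-partial group Steiner tree: given a weighted graph (here a tree) $G=(V,E,w)$ with $w:E\to\mathbb{R}_{\ge1}$ and root $r$, an adversary reveals at step $t$ a group of groups $\mathcal{G}_t=\{g^{(t)}_1,\ldots,g^{(t)}_{k_t}\}$ with each $g^{(t)}_j\subseteq V$, together with a requirement $f_t$. Let $n_i=|\{v:\exists j,\ v\in g^{(i)}_j\}|$. At step $t$ the algorithm outputs an edge set $T_t\supseteq T_{t-1}$. It is $\rho$-connection-competitive if for every $t$ and $i\le t$, at least $\rho f_i$ groups $g^{(i)}_j\in\mathcal{G}_i$ contain a vertex connected to $r$ by $T_t$. It is $c$-cost-competitive if $\max_t w(T_t)/\mathrm{OPT}_t\le c$, where $w(F)=\sum_{e\in F}w(e)$ and $\mathrm{OPT}_t$ is the minimum weight of a tree containing $r$ that, for every $i\le t$, intersects at least $f_i$ groups of $\mathcal{G}_i$.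
   Formalization: The cost bound with n_i as the number of distinct vertices is proved when the groups within each step are pairwise disjoint; for overlapping groups it fails as stated, and n_i is replaced by the sum of the group sizes. Polynomial time is in a unit-cost exact real-arithmetic model. *)

theory Defs
  imports Complex_Main "HOL-Library.Disjoint_Sets"
begin

section \<open>Weighted graphs and trees\<close>

text \<open>Edges are two-element vertex sets. Vertices are natural numbers, so that an instance
  can be handed to a program.\<close>

record wgraph =
  verts :: "nat set"
  edges :: "nat set set"
  wt    :: "nat set \<Rightarrow> real"

definition connected_by :: "nat set set \<Rightarrow> nat \<Rightarrow> nat \<Rightarrow> bool" where
  "connected_by F x y \<longleftrightarrow> (x, y) \<in> {(a, b). {a, b} \<in> F}\<^sup>*"

definition is_cycle :: "nat set set \<Rightarrow> nat list \<Rightarrow> bool" where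
  "is_cycle F xs \<longleftrightarrow> 3 \<le> length xs \<and> distinct xs \<and>
     (\<forall>i<length xs. {xs ! i, xs ! (Suc i mod length xs)} \<in> F)"

definition is_graph :: "nat set \<Rightarrow> nat set set \<Rightarrow> bool" where
  "is_graph U F \<longleftrightarrow> finite U \<and> (\<forall>e\<in>F. e \<subseteq> U \<and> card e = 2)"

definition is_tree :: "nat set \<Rightarrow> nat set set \<Rightarrow> bool" where
  "is_tree U F \<longleftrightarrow> is_graph U F \<and> U \<noteq> {} \<and>
     (\<forall>x\<in>U. \<forall>y\<in>U. connected_by F x y) \<and> (\<nexists>xs. is_cycle F xs)"

definition weighted_tree :: "wgraph \<Rightarrow> bool" where
  "weighted_tree G \<longleftrightarrow> is_tree (verts G) (edges G) \<and> (\<forall>e\<in>edges G. 1 \<le> wt G e)"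

definition weight :: "wgraph \<Rightarrow> nat set set \<Rightarrow> real" where
  "weight G F = (\<Sum>e\<in>F. wt G e)"

section \<open>The online problem\<close>

text \<open>A request is the list \<open>g\<^sub>1, \<dots>, g\<^sub>k\<close> of groups together with the requirement.
  Steps are numbered from 0.\<close>

type_synonym request = "nat set list \<times> nat"

abbreviation groups :: "request \<Rightarrow> nat set list" where "groups R \<equiv> fst R"
abbreviation requirement :: "request \<Rightarrow> nat" where "requirement R \<equiv> snd R"

text \<open>In a connected graph, the upper bound on the requirement says exactly that the
  request can be satisfied.\<close>

definition valid_request :: "wgraph \<Rightarrow> request \<Rightarrow> bool" where
  "valid_request G R \<longleftrightarrow> (\<forall>g\<in>set (groups R). g \<subseteq> verts G) \<and>
     1 \<le> requirement R \<and>
     requirement R \<le> card {j. j < length (groups R) \<and> groups R ! j \<noteq> {}}"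

definition tree_instance :: "wgraph \<Rightarrow> nat \<Rightarrow> request list \<Rightarrow> bool" where
  "tree_instance G r \<sigma> \<longleftrightarrow>
     weighted_tree G \<and> r \<in> verts G \<and> (\<forall>R\<in>set \<sigma>. valid_request G R)"

definition groups_hit :: "nat set \<Rightarrow> request \<Rightarrow> nat" where
  "groups_hit U R = card {j. j < length (groups R) \<and> groups R ! j \<inter> U \<noteq> {}}"

definition n_verts :: "request \<Rightarrow> nat" where
  "n_verts R = card {v. \<exists>g\<in>set (groups R). v \<in> g}"

text \<open>The number of vertices, where a vertex lying in several groups is counted once for
  each of them. It agrees with \<^const>\<open>n_verts\<close> if the groups are pairwise disjoint.\<close>

definition n_incidences :: "request \<Rightarrow> nat" where
  "n_incidences R = (\<Sum>j<length (groups R). card (groups R ! j))"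

definition disjoint_groups :: "request \<Rightarrow> bool" where
  "disjoint_groups R \<longleftrightarrow> disjoint_family_on (\<lambda>j. groups R ! j) {..<length (groups R)}"

definition OPT :: "wgraph \<Rightarrow> nat \<Rightarrow> request list \<Rightarrow> nat \<Rightarrow> real" where
  "OPT G r \<sigma> t = Min {weight G F | U F.
     U \<subseteq> verts G \<and> F \<subseteq> edges G \<and> is_tree U F \<and> r \<in> U \<and>
     (\<forall>i\<le>t. requirement (\<sigma> ! i) \<le> groups_hit U (\<sigma> ! i))}"

text \<open>A deterministic online algorithm maps the graph, the root and the requests revealed so
  far to its current edge set.\<close>

type_synonym online_alg = "wgraph \<Rightarrow> nat \<Rightarrow> request list \<Rightarrow> nat set set"

definition output_at :: "online_alg \<Rightarrow> wgraph \<Rightarrow> nat \<Rightarrow> request list \<Rightarrow> nat \<Rightarrow> nat set set" where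
  "output_at A G r \<sigma> t = A G r (take (Suc t) \<sigma>)"

definition online_feasible :: "online_alg \<Rightarrow> wgraph \<Rightarrow> nat \<Rightarrow> request list \<Rightarrow> bool" where
  "online_feasible A G r \<sigma> \<longleftrightarrow>
     (\<forall>t<length \<sigma>. output_at A G r \<sigma> t \<subseteq> edges G) \<and>
     (\<forall>t. Suc t < length \<sigma> \<longrightarrow> output_at A G r \<sigma> t \<subseteq> output_at A G r \<sigma> (Suc t))"

definition connection_competitive ::
  "real \<Rightarrow> online_alg \<Rightarrow> wgraph \<Rightarrow> nat \<Rightarrow> request list \<Rightarrow> bool" where
  "connection_competitive \<rho> A G r \<sigma> \<longleftrightarrow>
     (\<forall>t<length \<sigma>. \<forall>i\<le>t. \<rho> * real (requirement (\<sigma> ! i))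
        \<le> real (groups_hit {v. connected_by (output_at A G r \<sigma> t) r v} (\<sigma> ! i)))"

text \<open>Written without division, so that the case of optimum 0 is covered as well.\<close>

definition cost_competitive ::
  "real \<Rightarrow> online_alg \<Rightarrow> wgraph \<Rightarrow> nat \<Rightarrow> request list \<Rightarrow> bool" where
  "cost_competitive c A G r \<sigma> \<longleftrightarrow>
     (\<forall>t<length \<sigma>. weight G (output_at A G r \<sigma> t) \<le> c * OPT G r \<sigma> t)"

definition max_ratio :: "(request \<Rightarrow> nat) \<Rightarrow> request list \<Rightarrow> real" where
  "max_ratio n \<sigma> = Max ((\<lambda>R. real (n R) / real (requirement R)) ` set \<sigma>)"

section \<open>Polynomial time\<close>

text \<open>Weights are arbitrary real numbers, so the machine model is one with exact real
  arithmetic at unit cost (as in the real RAM or the Blum-Shub-Smale model), without rounding.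
  Programs are first-order recursive functions over binary trees whose leaves hold real
  numbers. The only literals are natural numbers, and every operation costs one unit.\<close>

datatype val = VNum real | VNil | VCons val val

fun num_of :: "val \<Rightarrow> real" where
  "num_of (VNum x) = x"
| "num_of _ = 0"

fun head_of :: "val \<Rightarrow> val" where
  "head_of (VCons a b) = a"
| "head_of _ = VNil"

fun tail_of :: "val \<Rightarrow> val" where
  "tail_of (VCons a b) = b"
| "tail_of _ = VNil"

definition bool_val :: "bool \<Rightarrow> val" where
  "bool_val b = (if b then VNum 1 else VNil)"

datatype unop = Head | Tail
datatype binop = Cons_op | Add | Sub | Mul | Div | Less | Equal

fun apply_un :: "unop \<Rightarrow> val \<Rightarrow> val" where
  "apply_un Head a = head_of a"
| "apply_un Tail a = tail_of a"

fun apply_bin :: "binop \<Rightarrow> val \<Rightarrow> val \<Rightarrow> val" where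
  "apply_bin Cons_op a b = VCons a b"
| "apply_bin Add a b = VNum (num_of a + num_of b)"
| "apply_bin Sub a b = VNum (num_of a - num_of b)"
| "apply_bin Mul a b = VNum (num_of a * num_of b)"
| "apply_bin Div a b = VNum (num_of a / num_of b)"
| "apply_bin Less a b = bool_val (num_of a < num_of b)"
| "apply_bin Equal a b = bool_val (num_of a = num_of b)"

text \<open>\<open>Var i\<close> is a de Bruijn index; \<open>Call f e\<close> applies the \<open>f\<close>-th function of the program to
  the value of \<open>e\<close>. Conditionals treat \<open>VNil\<close> as false and all other values as true.\<close>

datatype expr =
    Var nat | Lit nat | Null
  | Op1 unop expr
  | Op2 binop expr expr
  | Cond expr expr expr
  | LetIn expr expr
  | Call nat expr

type_synonym program = "expr list"

text \<open>\<open>eval P env e v t\<close>: under program \<open>P\<close>, the expression \<open>e\<close> evaluates to \<open>v\<close> in \<open>t\<close> steps.\<close>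

inductive eval :: "program \<Rightarrow> val list \<Rightarrow> expr \<Rightarrow> val \<Rightarrow> nat \<Rightarrow> bool" for P :: program where
  Var: "i < length env \<Longrightarrow> eval P env (Var i) (env ! i) 1"
| Lit: "eval P env (Lit n) (VNum (real n)) 1"
| Null: "eval P env Null VNil 1"
| Op1: "eval P env e v t \<Longrightarrow> eval P env (Op1 f e) (apply_un f v) (t + 1)"
| Op2: "\<lbrakk>eval P env e1 v1 t1; eval P env e2 v2 t2\<rbrakk>
    \<Longrightarrow> eval P env (Op2 f e1 e2) (apply_bin f v1 v2) (t1 + t2 + 1)"
| CondTrue: "\<lbrakk>eval P env b v t1; v \<noteq> VNil; eval P env e1 v1 t2\<rbrakk>
    \<Longrightarrow> eval P env (Cond b e1 e2) v1 (t1 + t2 + 1)"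
| CondFalse: "\<lbrakk>eval P env b VNil t1; eval P env e2 v2 t2\<rbrakk>
    \<Longrightarrow> eval P env (Cond b e1 e2) v2 (t1 + t2 + 1)"
| LetIn: "\<lbrakk>eval P env e1 v1 t1; eval P (v1 # env) e2 v2 t2\<rbrakk>
    \<Longrightarrow> eval P env (LetIn e1 e2) v2 (t1 + t2 + 1)"
| Call: "\<lbrakk>f < length P; eval P env e v1 t1; eval P [v1] (P ! f) v2 t2\<rbrakk>
    \<Longrightarrow> eval P env (Call f e) v2 (t1 + t2 + 1)"

lemma eval_deterministic:
  "eval P env e v t \<Longrightarrow> eval P env e v' t' \<Longrightarrow> v' = v \<and> t' = t"
proof (induction arbitrary: v' t' rule: eval.induct)
  case (Var i env) from Var.prems show ?case by cases auto
next
  case (Lit env n) from Lit.prems show ?case by cases auto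
next
  case (Null env) from Null.prems show ?case by cases auto
next
  case (Op1 env e v t f) from Op1.prems Op1.IH show ?case by cases auto
next
  case (Op2 env e1 v1 t1 e2 v2 t2 f)
  from Op2.prems show ?case by cases (use Op2.IH in blast)
next
  case (CondTrue env b v t1 e1 v1 t2 e2)
  from CondTrue.prems show ?case by cases (use CondTrue.IH CondTrue.hyps in blast)+
next
  case (CondFalse env b t1 e2 v2 t2 e1)
  from CondFalse.prems show ?case by cases (use CondFalse.IH in blast)+
next
  case (LetIn env e1 v1 t1 e2 v2 t2)
  from LetIn.prems show ?case by cases (use LetIn.IH in blast)
next
  case (Call f env e v1 t1 v2 t2)
  from Call.prems show ?case by cases (use Call.IH in blast)
qed

fun val_size :: "val \<Rightarrow> nat" where
  "val_size (VCons a b) = val_size a + val_size b + 1"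
| "val_size _ = 1"

definition enc_list :: "('a \<Rightarrow> val) \<Rightarrow> 'a list \<Rightarrow> val" where
  "enc_list f xs = foldr (\<lambda>x v. VCons (f x) v) xs VNil"

definition enc_nat :: "nat \<Rightarrow> val" where
  "enc_nat n = VNum (real n)"

definition enc_set :: "nat set \<Rightarrow> val" where
  "enc_set S = enc_list enc_nat (sorted_list_of_set S)"

definition edge_list :: "wgraph \<Rightarrow> (nat \<times> nat) list" where
  "edge_list G =
     filter (\<lambda>(u, v). u < v \<and> {u, v} \<in> edges G)
       (List.product (sorted_list_of_set (verts G)) (sorted_list_of_set (verts G)))"

definition enc_graph :: "wgraph \<Rightarrow> val" where
  "enc_graph G = VCons (enc_set (verts G))
     (enc_list (\<lambda>(u, v). VCons (enc_nat u) (VCons (enc_nat v) (VNum (wt G {u, v}))))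
       (edge_list G))"

definition enc_request :: "request \<Rightarrow> val" where
  "enc_request R = VCons (enc_nat (requirement R)) (enc_list enc_set (groups R))"

definition enc_input :: "real \<Rightarrow> wgraph \<Rightarrow> nat \<Rightarrow> request list \<Rightarrow> val" where
  "enc_input \<epsilon> G r \<sigma> =
     VCons (VNum \<epsilon>) (VCons (enc_graph G) (VCons (enc_nat r) (enc_list enc_request \<sigma>)))"

definition represents :: "val \<Rightarrow> nat set set \<Rightarrow> bool" where
  "represents v F \<longleftrightarrow>
     (\<exists>ps. v = enc_list (\<lambda>(a, b). VCons (enc_nat a) (enc_nat b)) ps \<and>
           F = {{a, b} | a b. (a, b) \<in> set ps})"

text \<open>Each output of the online algorithm is computed, by one program, in time polynomial in
  the size of the input seen so far. The real parameter \<open>\<epsilon>\<close> is the only non-integer constant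
  available to the program.\<close>

definition poly_time_on_trees :: "real \<Rightarrow> online_alg \<Rightarrow> bool" where
  "poly_time_on_trees \<epsilon> A \<longleftrightarrow>
     (\<exists>(P :: program) (C :: nat) (d :: nat). \<forall>G r \<sigma>. tree_instance G r \<sigma> \<longrightarrow>
        (\<exists>v t. eval P [enc_input \<epsilon> G r \<sigma>] (Call 0 (Var 0)) v t \<and>
               represents v (A G r \<sigma>) \<and>
               t \<le> C * val_size (enc_input \<epsilon> G r \<sigma>) ^ d))"

end

theory Submission
  imports Defs
begin

text \<open>Primal-dual charging: let \<open>S\<close> be the vertices connected to the root by the bought edges. While
  fewer than \<open>(1 - \<epsilon>) f\<close> groups of the current request meet \<open>S\<close>, every incidence of a vertex
  outside \<open>S\<close> with a group lowers, at unit rate, the residual weight of the edge on which the path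
  from the root to that vertex leaves \<open>S\<close>, until some residual weight vanishes and its edge is
  bought. At most \<open>n\<close> incidences pay. The optimum reaches at least \<open>\<epsilon> f\<close> groups that miss \<open>S\<close>, so
  at least \<open>\<epsilon> f\<close> of the incidences pay for edges of the optimum; altogether those can be charged no
  more than their weight. Hence the total charge, which bounds the weight bought, is at most
  \<open>n / (\<epsilon> f)\<close> times the optimum.

  Running time: functions between encodable types that are computed by a program in polynomial time
  are closed under composition, branching, and folds over lists whose state grows additively, so it
  suffices to write the algorithm as such a function.\<close>

section \<open>Polynomial-time functions on encoded types\<close>

text \<open>A vertex of the optimum may lie in several missed groups, and each of these groups has
  to contribute its own unit to the lower bound \<open>\<epsilon> f\<close>. It is therefore charged
  once per group, and the natural upper bound on the load is \<open>n_incidences\<close>; for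
  disjoint groups this equals \<open>n_verts\<close>.

  What makes the charges compose is that the estimate "decrease of all residuals is at most
  \<open>K\<close> times the decrease on \<open>F\<close>" is linear, with the same \<open>F\<close>
  and \<open>K\<close> throughout: one optimal tree \<open>F\<close> hits every request of the
  prefix, and \<open>K\<close>, the largest ratio divided by \<open>\<epsilon>\<close>, is at least
  \<open>n / (\<epsilon> f)\<close> for each of them. So it can be added up over rounds and requests
  without recording which request paid for which edge.

  The edge through which a path leaves the bought component is described by cuts instead of paths:
  deleting it separates the vertex from the root. The program can test this by a reachability
  search, and acyclicity makes the edge unique.\<close>

class encodable =
  fixes encode :: "'a \<Rightarrow> val"

instantiation nat :: encodable
begin
definition "encode = enc_nat"
instance ..
end

instantiation real :: encodable
begin
definition "encode = VNum"
instance ..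
end

instantiation bool :: encodable
begin
definition "encode = bool_val"
instance ..
end

instantiation list :: (encodable) encodable
begin
definition "encode = enc_list encode"
instance ..
end

instantiation prod :: (encodable, encodable) encodable
begin
definition "encode = (\<lambda>(x, y). VCons (encode x) (encode y))"
instance ..
end

definition esize :: "'a::encodable \<Rightarrow> nat" where
  "esize x = val_size (encode x)"

lemma encode_simps [simp]:
  "encode (x, y) = VCons (encode x) (encode y)"
  "encode [] = VNil"
  "encode (a # xs) = VCons (encode a) (encode xs)"
  by (simp_all add: encode_prod_def encode_list_def enc_list_def)

lemma esize_simps [simp]:
  "esize (x, y) = esize x + esize y + 1"
  "esize [] = 1"
  "esize (a # xs) = esize a + esize xs + 1"
  "esize (n :: nat) = 1"
  "esize (z :: real) = 1"
  "esize (b :: bool) = 1"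
  by (simp_all add: esize_def encode_nat_def encode_real_def encode_bool_def enc_nat_def
      bool_val_def)

lemma esize_pos [simp]: "0 < esize x"
proof -
  have "0 < val_size v" for v by (cases v) auto
  then show ?thesis by (simp add: esize_def)
qed

lemma esize_prod: "esize p = esize (fst p) + esize (snd p) + 1"
  by (cases p) simp

lemma length_less_esize: "length xs < esize xs"
  by (induction xs) auto

lemma esize_mem: "a \<in> set xs \<Longrightarrow> esize a \<le> esize xs"
  by (induction xs) auto

section \<open>Polynomial bounds in the size of the encoding\<close>

definition poly_bounded :: "('a::encodable \<Rightarrow> nat) \<Rightarrow> bool" where
  "poly_bounded g \<longleftrightarrow> (\<exists>C d. \<forall>x. g x \<le> C * esize x ^ d)"

lemma poly_bounded_mono: "poly_bounded h \<Longrightarrow> (\<And>x. g x \<le> h x) \<Longrightarrow> poly_bounded g"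
  unfolding poly_bounded_def by (meson order_trans)

lemma poly_bounded_const: "poly_bounded (\<lambda>x. c)"
  unfolding poly_bounded_def by (rule exI[of _ c], rule exI[of _ 0]) simp

lemma poly_bounded_esize: "poly_bounded esize"
  unfolding poly_bounded_def by (rule exI[of _ 1], rule exI[of _ 1]) simp

lemma poly_bounded_add:
  assumes "poly_bounded g" "poly_bounded h"
  shows "poly_bounded (\<lambda>x. g x + h x)"
proof -
  obtain C d D e where C: "\<And>x. g x \<le> C * esize x ^ d" and D: "\<And>x. h x \<le> D * esize x ^ e"
    using assms unfolding poly_bounded_def by blast
  \<comment> \<open>Sizes are at least 1, so both exponents can be raised to \<open>d + e\<close>;
    this is why single monomials suffice as bounds.\<close>
  have "g x + h x \<le> (C + D) * esize x ^ (d + e)" for x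
  proof -
    have "1 \<le> esize x" using esize_pos[of x] by linarith
    then have "C * esize x ^ d \<le> C * esize x ^ (d + e)" "D * esize x ^ e \<le> D * esize x ^ (d + e)"
      by (auto intro!: mult_le_mono2 power_increasing)
    then show ?thesis using add_mono[OF C[of x] D[of x]] unfolding distrib_right by linarith
  qed
  then show ?thesis unfolding poly_bounded_def by blast
qed

lemma poly_bounded_mult:
  assumes "poly_bounded g" "poly_bounded h"
  shows "poly_bounded (\<lambda>x. g x * h x)"
proof -
  obtain C d D e where C: "\<And>x. g x \<le> C * esize x ^ d" and D: "\<And>x. h x \<le> D * esize x ^ e"
    using assms unfolding poly_bounded_def by blast
  have "g x * h x \<le> (C * D) * esize x ^ (d + e)" for x
    using mult_le_mono[OF C[of x] D[of x]] by (simp add: power_add mult_ac)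
  then show ?thesis unfolding poly_bounded_def by blast
qed

lemma poly_bounded_Suc: "poly_bounded g \<Longrightarrow> poly_bounded (\<lambda>x. Suc (g x))"
  using poly_bounded_add[OF _ poly_bounded_const[of 1]] by simp

lemma poly_bounded_power: "poly_bounded g \<Longrightarrow> poly_bounded (\<lambda>x. g x ^ n)"
  by (induction n) (auto intro: poly_bounded_const poly_bounded_mult)

lemma poly_bounded_compose:
  assumes "poly_bounded g" "poly_bounded (\<lambda>x. esize (h x))"
  shows "poly_bounded (\<lambda>x. g (h x))"
proof -
  obtain C d where C: "\<And>x. g x \<le> C * esize x ^ d"
    using assms(1) unfolding poly_bounded_def by blast
  have "poly_bounded (\<lambda>x. C * esize (h x) ^ d)"
    by (intro poly_bounded_mult poly_bounded_const poly_bounded_power assms(2))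
  then show ?thesis by (rule poly_bounded_mono) (rule C)
qed

section \<open>Upper bounds on running times, and joining programs\<close>

definition runs :: "program \<Rightarrow> val list \<Rightarrow> expr \<Rightarrow> val \<Rightarrow> nat \<Rightarrow> bool" where
  "runs P env e v n \<longleftrightarrow> (\<exists>t\<le>n. eval P env e v t)"

lemma runs_mono: "runs P env e v n \<Longrightarrow> n \<le> m \<Longrightarrow> runs P env e v m"
  unfolding runs_def by (meson order_trans)

lemma runs_Var: "i < length env \<Longrightarrow> v = env ! i \<Longrightarrow> runs P env (Var i) v 1"
  unfolding runs_def using eval.Var by blast

lemma runs_Lit: "runs P env (Lit n) (VNum (real n)) 1"
  unfolding runs_def using eval.Lit by blast

lemma runs_Null: "runs P env Null VNil 1"
  unfolding runs_def using eval.Null by blast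

lemma runs_Op1: "runs P env e v n \<Longrightarrow> w = apply_un f v \<Longrightarrow> runs P env (Op1 f e) w (n + 1)"
  unfolding runs_def by (metis eval.Op1 add_le_mono1)

lemma runs_Op2:
  "\<lbrakk>runs P env e1 v1 n1; runs P env e2 v2 n2; w = apply_bin f v1 v2\<rbrakk>
    \<Longrightarrow> runs P env (Op2 f e1 e2) w (n1 + n2 + 1)"
  unfolding runs_def by (metis eval.Op2 add_le_mono add_le_mono1)

lemma runs_CondTrue:
  "\<lbrakk>runs P env b v n1; v \<noteq> VNil; runs P env e1 w n2\<rbrakk>
    \<Longrightarrow> runs P env (Cond b e1 e2) w (n1 + n2 + 1)"
  unfolding runs_def by (metis eval.CondTrue add_le_mono add_le_mono1)

lemma runs_CondFalse:
  "\<lbrakk>runs P env b VNil n1; runs P env e2 w n2\<rbrakk> \<Longrightarrow> runs P env (Cond b e1 e2) w (n1 + n2 + 1)"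
  unfolding runs_def by (metis eval.CondFalse add_le_mono add_le_mono1)

lemma runs_LetIn:
  "\<lbrakk>runs P env e1 v n1; runs P (v # env) e2 w n2\<rbrakk>
    \<Longrightarrow> runs P env (LetIn e1 e2) w (n1 + n2 + 1)"
  unfolding runs_def by (metis eval.LetIn add_le_mono add_le_mono1)

lemma runs_Call:
  "\<lbrakk>f < length P; runs P env e v n1; runs P [v] (P ! f) w n2\<rbrakk>
    \<Longrightarrow> runs P env (Call f e) w (n1 + n2 + 1)"
  unfolding runs_def by (metis eval.Call add_le_mono add_le_mono1)

text \<open>Code written for a one-entry environment can thus run inside a \<open>LetIn\<close>,
  where outer entries lie behind its argument.\<close>

lemma eval_append_env: "eval P env e v t \<Longrightarrow> eval P (env @ env') e v t"
proof (induction rule: eval.induct)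
  case (Var i env)
  then show ?case using eval.Var[of i "env @ env'" P] by (simp add: nth_append)
qed (auto intro: eval.intros simp del: One_nat_def)

lemma eval_append_program: "eval P env e v t \<Longrightarrow> eval (P @ Q) env e v t"
proof (induction rule: eval.induct)
  case (Call f env e v1 t1 v2 t2)
  then show ?case using eval.Call[of f "P @ Q"] by (simp add: nth_append)
qed (auto intro: eval.intros simp del: One_nat_def)

text \<open>Makes programs concatenable: the functions of the first keep their indices, those of the
  second move up by the length of the first, and their calls with them.\<close>

primrec shift_calls :: "nat \<Rightarrow> expr \<Rightarrow> expr" where
  "shift_calls k (Var i) = Var i"
| "shift_calls k (Lit n) = Lit n"
| "shift_calls k Null = Null"
| "shift_calls k (Op1 f e) = Op1 f (shift_calls k e)"
| "shift_calls k (Op2 f e1 e2) = Op2 f (shift_calls k e1) (shift_calls k e2)"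
| "shift_calls k (Cond b e1 e2) = Cond (shift_calls k b) (shift_calls k e1) (shift_calls k e2)"
| "shift_calls k (LetIn e1 e2) = LetIn (shift_calls k e1) (shift_calls k e2)"
| "shift_calls k (Call f e) = Call (k + f) (shift_calls k e)"

lemma eval_shift_calls:
  "eval Q env e v t \<Longrightarrow>
    eval (P @ map (shift_calls (length P)) Q) env (shift_calls (length P) e) v t"
proof (induction rule: eval.induct)
  case (Call f env e v1 t1 v2 t2)
  then show ?case
    using eval.Call[of "length P + f" "P @ map (shift_calls (length P)) Q"]
    by (simp add: nth_append)
qed (auto intro: eval.intros simp del: One_nat_def)

lemma runs_append_env: "runs P env e v n \<Longrightarrow> runs P (env @ env') e v n"
  unfolding runs_def using eval_append_env by blast

lemma runs_append_program: "runs P env e v n \<Longrightarrow> runs (P @ Q) env e v n"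
  unfolding runs_def using eval_append_program by blast

lemma runs_shift_calls:
  "runs Q env e v n \<Longrightarrow>
    runs (P @ map (shift_calls (length P)) Q) env (shift_calls (length P) e) v n"
  unfolding runs_def using eval_shift_calls by blast

definition computes :: "program \<Rightarrow> expr \<Rightarrow> ('a::encodable \<Rightarrow> 'b::encodable) \<Rightarrow> ('a \<Rightarrow> nat) \<Rightarrow> bool" where
  "computes P e f \<tau> \<longleftrightarrow> (\<forall>x. runs P [encode x] e (encode (f x)) (\<tau> x))"

text \<open>The bound on the size of the result does not follow from the bound on the running time,
  as a program can share subtrees.\<close>

definition poly_time :: "('a::encodable \<Rightarrow> 'b::encodable) \<Rightarrow> bool" where
  "poly_time f \<longleftrightarrow> poly_bounded (\<lambda>x. esize (f x)) \<and>
     (\<exists>P e \<tau>. poly_bounded \<tau> \<and> computes P e f \<tau>)"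

lemma poly_timeI:
  "\<lbrakk>poly_bounded (\<lambda>x. esize (f x)); poly_bounded \<tau>; computes P e f \<tau>\<rbrakk> \<Longrightarrow> poly_time f"
  unfolding poly_time_def by blast

lemma poly_timeE:
  assumes "poly_time f"
  obtains P e \<tau> where "poly_bounded (\<lambda>x. esize (f x))" "poly_bounded \<tau>" "computes P e f \<tau>"
  using assms unfolding poly_time_def by blast

lemma computes_append: "computes P e f \<tau> \<Longrightarrow> computes (P @ Q) e f \<tau>"
  unfolding computes_def using runs_append_program by blast

lemma computes_shift:
  "computes Q e f \<tau> \<Longrightarrow>
    computes (P @ map (shift_calls (length P)) Q) (shift_calls (length P) e) f \<tau>"
  unfolding computes_def using runs_shift_calls by blast

lemma common_program:
  assumes "computes P e f \<tau>" "computes Q e' g \<tau>'"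
  obtains R d d' where "computes R d f \<tau>" "computes R d' g \<tau>'"
  using assms computes_append computes_shift by blast

lemma poly_time_esize: "poly_time f \<Longrightarrow> poly_bounded (\<lambda>x. esize (f x))"
  by (simp add: poly_time_def)

lemma poly_time_lift1:
  assumes "poly_time f" "poly_bounded (\<lambda>x. esize (h x))"
    "\<And>x. encode (h x) = apply_un k (encode (f x))"
  shows "poly_time h"
  using assms(1)
proof (rule poly_timeE)
  fix P e \<tau>
  assume \<tau>: "poly_bounded \<tau>" and e: "computes P e f \<tau>"
  show ?thesis
  proof (rule poly_timeI)
    show "computes P (Op1 k e) h (\<lambda>x. \<tau> x + 1)"
      using e assms(3) runs_Op1 unfolding computes_def by blast
  qed (auto intro!: poly_bounded_add poly_bounded_Suc \<tau> poly_bounded_const assms(2))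
qed

lemma poly_time_lift2:
  assumes "poly_time f" "poly_time g" "poly_bounded (\<lambda>x. esize (h x))"
    "\<And>x. encode (h x) = apply_bin k (encode (f x)) (encode (g x))"
  shows "poly_time h"
proof -
  obtain P e \<tau> Q e' \<tau>' where \<tau>: "poly_bounded \<tau>" "poly_bounded \<tau>'"
    and e: "computes P e f \<tau>" "computes Q e' g \<tau>'"
    using assms(1,2) by (metis poly_timeE)
  obtain R d d' where R: "computes R d f \<tau>" "computes R d' g \<tau>'"
    using common_program[OF e] by blast
  show ?thesis
  proof (rule poly_timeI)
    show "computes R (Op2 k d d') h (\<lambda>x. \<tau> x + \<tau>' x + 1)"
      using R assms(4) runs_Op2 unfolding computes_def by blast
  qed (auto intro!: poly_bounded_add poly_bounded_Suc \<tau> poly_bounded_const assms(3))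
qed

section \<open>Closure under composition, arithmetic and branching\<close>

named_theorems poly_time_intros

lemma poly_time_id [poly_time_intros]: "poly_time (\<lambda>x. x)"
proof (rule poly_timeI)
  show "computes [] (Var 0) (\<lambda>x. x) (\<lambda>x. 1)"
    unfolding computes_def by (simp add: runs_Var del: One_nat_def)
qed (auto intro: poly_bounded_esize[unfolded atomize_eq] poly_bounded_const)

lemma poly_time_compose:
  assumes "poly_time g" "poly_time f"
  shows "poly_time (\<lambda>x. g (f x))"
proof -
  obtain P e \<tau> Q e' \<tau>' where \<tau>: "poly_bounded \<tau>" "poly_bounded \<tau>'"
    and e: "computes P e f \<tau>" "computes Q e' g \<tau>'"
    using assms by (metis poly_timeE)
  obtain R d d' where R: "computes R d f \<tau>" "computes R d' g \<tau>'"
    using common_program[OF e] by blast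
  have size: "poly_bounded (\<lambda>x. esize (f x))" "poly_bounded (\<lambda>x. esize (g x))"
    using assms poly_time_esize by blast+
  show ?thesis
  proof (rule poly_timeI)
    have "runs R [encode x] (LetIn d d') (encode (g (f x))) (\<tau> x + \<tau>' (f x) + 1)" for x
      using R runs_LetIn runs_append_env[of R "[encode (f x)]" _ _ _ "[encode x]"]
      unfolding computes_def by fastforce
    then show "computes R (LetIn d d') (\<lambda>x. g (f x)) (\<lambda>x. \<tau> x + \<tau>' (f x) + 1)"
      unfolding computes_def by blast
    show "poly_bounded (\<lambda>x. esize (g (f x)))"
      using poly_bounded_compose[OF size(2,1)] .
    show "poly_bounded (\<lambda>x. \<tau> x + \<tau>' (f x) + 1)"
      by (intro poly_bounded_add \<tau> poly_bounded_const poly_bounded_compose[OF \<tau>(2)] size)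
  qed
qed

lemma poly_time_Pair [poly_time_intros]:
  assumes "poly_time f" "poly_time g"
  shows "poly_time (\<lambda>x. (f x, g x))"
  by (rule poly_time_lift2[OF assms, of _ Cons_op])
     (auto intro!: poly_bounded_add poly_bounded_Suc poly_time_esize assms poly_bounded_const)

lemma poly_time_Cons [poly_time_intros]:
  assumes "poly_time f" "poly_time g"
  shows "poly_time (\<lambda>x. f x # g x)"
  by (rule poly_time_lift2[OF assms, of _ Cons_op])
     (auto intro!: poly_bounded_add poly_bounded_Suc poly_time_esize assms poly_bounded_const)

text \<open>Programs are first-order, so a function passed to \<open>map\<close> or
  \<open>filter\<close> is represented by its uncurried form on pairs of context and element. This
  rule evaluates such a form at computed arguments.\<close>

lemma poly_time_compose2:
  assumes "poly_time (\<lambda>p. h (fst p) (snd p))" "poly_time f" "poly_time g"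
  shows "poly_time (\<lambda>x. h (f x) (g x))"
  using poly_time_compose[OF assms(1) poly_time_Pair[OF assms(2,3)]] by simp

lemma poly_time_fst [poly_time_intros]:
  assumes "poly_time f"
  shows "poly_time (\<lambda>x. fst (f x))"
proof (rule poly_time_lift1[OF assms, of _ Head])
  show "poly_bounded (\<lambda>x. esize (fst (f x)))"
    by (rule poly_bounded_mono[OF poly_time_esize[OF assms]]) (simp add: esize_prod)
  show "encode (fst (f x)) = apply_un Head (encode (f x))" for x by (cases "f x") simp
qed

lemma poly_time_snd [poly_time_intros]:
  assumes "poly_time f"
  shows "poly_time (\<lambda>x. snd (f x))"
proof (rule poly_time_lift1[OF assms, of _ Tail])
  show "poly_bounded (\<lambda>x. esize (snd (f x)))"
    by (rule poly_bounded_mono[OF poly_time_esize[OF assms]]) (simp add: esize_prod)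
  show "encode (snd (f x)) = apply_un Tail (encode (f x))" for x by (cases "f x") simp
qed

lemma poly_time_const:
  assumes "\<And>P env. runs P env e (encode c) 1"
  shows "poly_time (\<lambda>x. c)"
proof (rule poly_timeI)
  show "computes [] e (\<lambda>x. c) (\<lambda>x. 1)"
    unfolding computes_def using assms by blast
qed (auto intro: poly_bounded_const)

lemma poly_time_Nil [poly_time_intros]: "poly_time (\<lambda>x. [])"
  using poly_time_const[of Null "[]"] runs_Null by simp

lemma poly_time_False [poly_time_intros]: "poly_time (\<lambda>x. False)"
  using poly_time_const[of Null False] runs_Null by (simp add: encode_bool_def bool_val_def)

lemma poly_time_True [poly_time_intros]: "poly_time (\<lambda>x. True)"
  using poly_time_const[of "Lit 1" True] runs_Lit[of _ _ 1]
  by (simp add: encode_bool_def bool_val_def)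

lemma poly_time_0 [poly_time_intros]: "poly_time (\<lambda>x. 0::real)"
  using poly_time_const[of "Lit 0" "0::real"] runs_Lit[of _ _ 0] by (simp add: encode_real_def)

lemma poly_time_1 [poly_time_intros]: "poly_time (\<lambda>x. 1::real)"
  using poly_time_const[of "Lit 1" "1::real"] runs_Lit[of _ _ 1] by (simp add: encode_real_def)

lemma poly_time_of_nat [poly_time_intros]:
  fixes f :: "'a::encodable \<Rightarrow> nat"
  assumes "poly_time f"
  shows "poly_time (\<lambda>x. real (f x))"
proof -
  have "encode (real n) = encode n" for n by (simp add: encode_real_def encode_nat_def enc_nat_def)
  then show ?thesis using assms unfolding poly_time_def computes_def by simp
qed

lemma poly_time_arith [poly_time_intros]:
  fixes f g :: "'a::encodable \<Rightarrow> real"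
  assumes "poly_time f" "poly_time g"
  shows "poly_time (\<lambda>x. f x + g x)" "poly_time (\<lambda>x. f x - g x)"
    "poly_time (\<lambda>x. f x * g x)" "poly_time (\<lambda>x. f x / g x)"
    "poly_time (\<lambda>x. f x < g x)" "poly_time (\<lambda>x. f x = g x)"
  by (rule poly_time_lift2[OF assms, of _ Add] poly_time_lift2[OF assms, of _ Sub]
      poly_time_lift2[OF assms, of _ Mul] poly_time_lift2[OF assms, of _ Div]
      poly_time_lift2[OF assms, of _ Less] poly_time_lift2[OF assms, of _ Equal];
      simp add: poly_bounded_const encode_real_def encode_bool_def; fail)+

lemma poly_time_eq_nat [poly_time_intros]:
  fixes f g :: "'a::encodable \<Rightarrow> nat"
  assumes "poly_time f" "poly_time g"
  shows "poly_time (\<lambda>x. f x = g x)"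
  using poly_time_arith(6)[OF assms[THEN poly_time_of_nat]] by simp

lemma poly_time_If [poly_time_intros]:
  assumes "poly_time b" "poly_time f" "poly_time g"
  shows "poly_time (\<lambda>x. if b x then f x else g x)"
proof -
  obtain P e \<tau> Q e' \<tau>' Q' e'' \<tau>'' where
    \<tau>: "poly_bounded \<tau>" "poly_bounded \<tau>'" "poly_bounded \<tau>''"
    and e: "computes P e b \<tau>" "computes Q e' f \<tau>'" "computes Q' e'' g \<tau>''"
    using assms by (metis poly_timeE)
  obtain R0 d0 d0' where R0: "computes R0 d0 b \<tau>" "computes R0 d0' f \<tau>'"
    using common_program[OF e(1,2)] by blast
  define R where "R = R0 @ map (shift_calls (length R0)) Q'"
  define d'' where "d'' = shift_calls (length R0) e''"
  have R: "computes R d0 b \<tau>" "computes R d0' f \<tau>'" "computes R d'' g \<tau>''"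
    unfolding R_def d''_def by (intro computes_append R0 computes_shift e)+
  show ?thesis
  proof (rule poly_timeI)
    \<comment> \<open>Both branches are billed, which keeps the bound a plain sum.\<close>
    have "runs R [encode x] (Cond d0 d0' d'') (encode (if b x then f x else g x))
        (\<tau> x + (\<tau>' x + \<tau>'' x) + 1)" for x
    proof (cases "b x")
      case True
      then have "encode (b x) \<noteq> VNil" by (simp add: encode_bool_def bool_val_def)
      then have "runs R [encode x] (Cond d0 d0' d'') (encode (f x)) (\<tau> x + \<tau>' x + 1)"
        using R unfolding computes_def by (blast intro: runs_CondTrue)
      then show ?thesis using True by (auto elim: runs_mono)
    next
      case False
      then have "encode (b x) = VNil" by (simp add: encode_bool_def bool_val_def)
      then have "runs R [encode x] (Cond d0 d0' d'') (encode (g x)) (\<tau> x + \<tau>'' x + 1)"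
        using R unfolding computes_def by (metis runs_CondFalse)
      then show ?thesis using False by (auto elim: runs_mono)
    qed
    then show "computes R (Cond d0 d0' d'') (\<lambda>x. if b x then f x else g x)
        (\<lambda>x. \<tau> x + (\<tau>' x + \<tau>'' x) + 1)"
      unfolding computes_def by blast
    show "poly_bounded (\<lambda>x. esize (if b x then f x else g x))"
      by (rule poly_bounded_mono[OF poly_bounded_add[OF assms(2,3)[THEN poly_time_esize]]]) auto
    show "poly_bounded (\<lambda>x. \<tau> x + (\<tau>' x + \<tau>'' x) + 1)"
      by (intro poly_bounded_add \<tau> poly_bounded_const)
  qed
qed

lemma poly_time_Not [poly_time_intros]:
  assumes "poly_time f" shows "poly_time (\<lambda>x. \<not> f x)"
proof -
  have "(\<lambda>x. \<not> f x) = (\<lambda>x. if f x then False else True)" by auto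
  then show ?thesis using poly_time_If[OF assms poly_time_False poly_time_True] by simp
qed

lemma poly_time_conj [poly_time_intros]:
  assumes "poly_time f" "poly_time g" shows "poly_time (\<lambda>x. f x \<and> g x)"
proof -
  have "(\<lambda>x. f x \<and> g x) = (\<lambda>x. if f x then g x else False)" by auto
  then show ?thesis using poly_time_If[OF assms poly_time_False] by simp
qed

lemma poly_time_disj [poly_time_intros]:
  assumes "poly_time f" "poly_time g" shows "poly_time (\<lambda>x. f x \<or> g x)"
proof -
  have "(\<lambda>x. f x \<or> g x) = (\<lambda>x. if f x then True else g x)" by auto
  then show ?thesis using poly_time_If[OF assms(1) poly_time_True assms(2)] by simp
qed

lemma poly_time_eq_bool [poly_time_intros]:
  assumes "poly_time f" "poly_time g" shows "poly_time (\<lambda>x. f x = (g x :: bool))"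
proof -
  have "poly_time (\<lambda>x. if f x then g x else \<not> g x)" by (intro poly_time_intros assms)
  moreover have "(\<lambda>x. if f x then g x else \<not> g x) = (\<lambda>x. f x = g x)" by auto
  ultimately show ?thesis by simp
qed

lemma poly_time_le [poly_time_intros]:
  fixes f g :: "'a::encodable \<Rightarrow> real"
  assumes "poly_time f" "poly_time g"
  shows "poly_time (\<lambda>x. f x \<le> g x)"
  using poly_time_Not[OF poly_time_arith(5)[OF assms(2,1)]] by (simp add: not_less)

text \<open>The argument is the triple of context, remaining list and state. With this body stored
  at index \<open>k\<close>, the call is a recursion; the context travels along because a called
  function sees only its argument.\<close>

definition loop_body :: "nat \<Rightarrow> expr \<Rightarrow> expr" where
  "loop_body k e = (let ctx = Op1 Head (Var 0); xs = Op1 Head (Op1 Tail (Var 0));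
       s = Op1 Tail (Op1 Tail (Var 0))
     in Cond xs
          (Call k (Op2 Cons_op ctx (Op2 Cons_op (Op1 Tail xs)
             (LetIn (Op2 Cons_op ctx (Op2 Cons_op (Op1 Head xs) s)) e))))
          s)"

text \<open>Besides the body, an iteration takes 25 steps for reading and rebuilding the triple,
  branching and calling, which 27 covers; the 7 pays for the last test and for returning the state.
  \<open>B\<close> has to bound \<open>\<tau>\<close> only on states reached after a prefix of the
  list.\<close>

lemma runs_loop:
  fixes c :: "'i::encodable" and xs :: "'a::encodable list" and s :: "'s::encodable"
  assumes P: "k < length P" "P ! k = loop_body k e"
    and step: "\<And>a s. runs P [encode (c, a, s)] e (encode (f a s)) (\<tau> (c, a, s))"
    and B: "\<And>ys a zs. xs = ys @ a # zs \<Longrightarrow> \<tau> (c, a, fold f ys s) \<le> B"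
  shows "runs P [encode (c, xs, s)] (P ! k) (encode (fold f xs s)) (length xs * (B + 27) + 7)"
  using B
proof (induction xs arbitrary: s)
  case Nil
  let ?env = "[encode (c, [] :: 'a list, s)]"
  have arg: "runs P ?env (Var 0) (encode (c, [] :: 'a list, s)) 1"
    by (rule runs_Var) simp_all
  have cdr: "runs P ?env (Op1 Tail (Var 0)) (encode ([] :: 'a list, s)) 2"
    by (rule runs_mono, rule runs_Op1[OF arg]) simp_all
  have lst: "runs P ?env (Op1 Head (Op1 Tail (Var 0))) VNil 3"
    by (rule runs_mono, rule runs_Op1[OF cdr]) simp_all
  have st: "runs P ?env (Op1 Tail (Op1 Tail (Var 0))) (encode s) 3"
    by (rule runs_mono, rule runs_Op1[OF cdr]) simp_all
  have "runs P ?env (loop_body k e) (encode s) (3 + 3 + 1)"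
    unfolding loop_body_def Let_def by (rule runs_CondFalse[OF lst st])
  then show ?case by (simp add: P)
next
  case (Cons a xs)
  let ?env = "[encode (c, a # xs, s)]"
  have IH: "runs P [encode (c, xs, f a s)] (P ! k) (encode (fold f xs (f a s)))
      (length xs * (B + 27) + 7)"
    by (rule Cons.IH) (metis Cons.prems append_Cons fold_simps(2))
  have arg: "runs P ?env (Var 0) (encode (c, a # xs, s)) 1"
    by (rule runs_Var) simp_all
  have ctx: "runs P ?env (Op1 Head (Var 0)) (encode c) 2"
    by (rule runs_mono, rule runs_Op1[OF arg]) simp_all
  have cdr: "runs P ?env (Op1 Tail (Var 0)) (encode (a # xs, s)) 2"
    by (rule runs_mono, rule runs_Op1[OF arg]) simp_all
  have lst: "runs P ?env (Op1 Head (Op1 Tail (Var 0))) (encode (a # xs)) 3"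
    by (rule runs_mono, rule runs_Op1[OF cdr]) simp_all
  have st: "runs P ?env (Op1 Tail (Op1 Tail (Var 0))) (encode s) 3"
    by (rule runs_mono, rule runs_Op1[OF cdr]) simp_all
  have hd: "runs P ?env (Op1 Head (Op1 Head (Op1 Tail (Var 0)))) (encode a) 4"
    by (rule runs_mono, rule runs_Op1[OF lst]) simp_all
  have tl: "runs P ?env (Op1 Tail (Op1 Head (Op1 Tail (Var 0)))) (encode xs) 4"
    by (rule runs_mono, rule runs_Op1[OF lst]) simp_all
  have e: "runs P (encode (c, a, s) # ?env) e (encode (f a s)) B"
    using runs_append_env[OF step[of a s], of ?env] Cons.prems[of "[]" a xs]
    by (auto elim: runs_mono)
  have "runs P ?env (Op2 Cons_op (Op1 Head (Var 0))
      (Op2 Cons_op (Op1 Head (Op1 Head (Op1 Tail (Var 0)))) (Op1 Tail (Op1 Tail (Var 0)))))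
      (encode (c, a, s)) (2 + (4 + 3 + 1) + 1)"
    by (rule runs_Op2[OF ctx runs_Op2[OF hd st refl]]) simp
  note next_state = runs_LetIn[OF this e]
  have "runs P ?env (Op2 Cons_op (Op1 Head (Var 0)) (Op2 Cons_op
      (Op1 Tail (Op1 Head (Op1 Tail (Var 0))))
      (LetIn (Op2 Cons_op (Op1 Head (Var 0))
        (Op2 Cons_op (Op1 Head (Op1 Head (Op1 Tail (Var 0)))) (Op1 Tail (Op1 Tail (Var 0))))) e)))
      (encode (c, xs, f a s)) (2 + (4 + (2 + (4 + 3 + 1) + 1 + B + 1) + 1) + 1)"
    by (rule runs_Op2[OF ctx runs_Op2[OF tl next_state refl]]) simp
  note call = runs_Call[OF P(1) this IH]
  have "encode (a # xs) \<noteq> VNil" by simp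
  note runs_CondTrue[OF lst this call]
  then have "runs P ?env (loop_body k e) (encode (fold f xs (f a s)))
     (length (a # xs) * (B + 27) + 7)"
    unfolding loop_body_def Let_def by (rule runs_mono) simp
  then show ?case by (simp add: P)
qed

text \<open>The additive bound on the growth of the state keeps the intermediate states, and hence
  all iterations, polynomially bounded.\<close>

lemma poly_time_fold:
  assumes f: "poly_time (\<lambda>u. f (fst u) (fst (snd u)) (snd (snd u)))"
    and xs: "poly_time xs" and s: "poly_time s" and q: "poly_bounded q"
    and grow: "\<And>i a t. a \<in> set (xs i) \<Longrightarrow> esize (f i a t) \<le> esize t + q i"
  shows "poly_time (\<lambda>i. fold (f i) (xs i) (s i))"
proof -
  let ?f = "\<lambda>u. f (fst u) (fst (snd u)) (snd (snd u))"
  have state: "esize (fold (f i) ys t) \<le> esize t + length ys * q i"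
    if "set ys \<subseteq> set (xs i)" for i ys t
    using that
  proof (induction ys arbitrary: t)
    case (Cons a ys)
    have "esize (fold (f i) (a # ys) t) \<le> esize (f i a t) + length ys * q i"
      using Cons.prems Cons.IH[of "f i a t"] by simp
    also have "\<dots> \<le> (esize t + q i) + length ys * q i"
      using grow[of a i t] Cons.prems by simp
    finally show ?case by simp
  qed simp
  have len: "length (xs i) * q i \<le> esize (xs i) * q i" for i
    using length_less_esize[of "xs i"] by simp
  note size = poly_time_esize[OF xs] poly_time_esize[OF s]
  \<comment> \<open>\<open>M i\<close> bounds the size of every intermediate state in the run on
    \<open>i\<close>.\<close>
  define M where "M = (\<lambda>i. esize (s i) + esize (xs i) * q i)"
  have M: "poly_bounded M"
    unfolding M_def by (intro poly_bounded_add poly_bounded_mult size q)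
  have out: "poly_bounded (\<lambda>i. esize (fold (f i) (xs i) (s i)))"
    by (rule poly_bounded_mono[OF M], unfold M_def)
      (use state len in \<open>meson add_left_mono order_refl order_trans\<close>)
  obtain P e \<tau> where \<tau>: "poly_bounded \<tau>" and e: "computes P e ?f \<tau>"
    using f by (rule poly_timeE)
  obtain C d where C: "\<And>u. \<tau> u \<le> C * esize u ^ d"
    using \<tau> unfolding poly_bounded_def by blast
  \<comment> \<open>The time of one iteration: the base of the power bounds the size of the triple
    of context, list element and state.\<close>
  define B where "B = (\<lambda>i. C * (esize i + (esize (xs i) + M i + 1) + 1) ^ d)"
  have B: "poly_bounded B"
    unfolding B_def by (intro poly_bounded_add poly_bounded_mult poly_bounded_power
        poly_bounded_const poly_bounded_esize size M)
  define k where "k = length P"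
  \<comment> \<open>The loop goes to the end, at index \<open>length P\<close>, so that the calls
    inside \<open>P\<close> stay valid.\<close>
  define P' where "P' = P @ [loop_body k e]"
  define g where "g = (\<lambda>(i, xs, s). fold (f i) xs s)"
  have loop: "runs P' [encode (i, xs i, s i)] (P' ! k) (encode (fold (f i) (xs i) (s i)))
      (length (xs i) * (B i + 27) + 7)" for i
  proof (rule runs_loop[where e = e and \<tau> = \<tau>])
    show "k < length P'" "P' ! k = loop_body k e" by (simp_all add: P'_def k_def)
    show "runs P' [encode (i, a, t)] e (encode (f i a t)) (\<tau> (i, a, t))" for a t
      using computes_append[OF e, of "[loop_body k e]"] unfolding computes_def P'_def
      by (metis fst_conv snd_conv)
  next
    fix ys a zs assume split: "xs i = ys @ a # zs"
    have "esize a \<le> esize (xs i)" by (rule esize_mem) (simp add: split)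
    moreover have "esize (fold (f i) ys (s i)) \<le> M i"
    proof -
      have "esize (fold (f i) ys (s i)) \<le> esize (s i) + length ys * q i"
        by (rule state) (auto simp: split)
      also have "\<dots> \<le> esize (s i) + length (xs i) * q i"
        by (intro add_left_mono mult_le_mono1) (simp add: split)
      also have "\<dots> \<le> M i" using len[of i] by (simp add: M_def)
      finally show ?thesis .
    qed
    ultimately have "esize (i, a, fold (f i) ys (s i)) \<le> esize i + (esize (xs i) + M i + 1) + 1"
      by simp
    then show "\<tau> (i, a, fold (f i) ys (s i)) \<le> B i"
      unfolding B_def by (meson C order_trans mult_le_mono2 power_mono zero_le)
  qed
  have "poly_time (\<lambda>i. (i, xs i, s i))" by (intro poly_time_intros xs s)
  then obtain Q e' \<tau>' where \<tau>': "poly_bounded \<tau>'" and e': "computes Q e' (\<lambda>i. (i, xs i, s i)) \<tau>'"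
    by (rule poly_timeE)
  define R where "R = P' @ map (shift_calls (length P')) Q"
  show ?thesis
  proof (rule poly_timeI[OF out])
    show "poly_bounded (\<lambda>i. \<tau>' i + (esize (xs i) * (B i + 27) + 7) + 1)"
      by (intro poly_bounded_add poly_bounded_mult poly_bounded_const size \<tau>' B)
    have "runs R [encode i] (Call k (shift_calls (length P') e')) (encode (fold (f i) (xs i) (s i)))
        (\<tau>' i + (esize (xs i) * (B i + 27) + 7) + 1)" for i
    proof (rule runs_Call)
      show "k < length R" by (simp add: R_def P'_def k_def)
      show "runs R [encode i] (shift_calls (length P') e') (encode (i, xs i, s i)) (\<tau>' i)"
        using computes_shift[OF e'] unfolding R_def computes_def by blast
      have "R ! k = P' ! k" by (simp add: R_def nth_append P'_def k_def)
      moreover have "length (xs i) * (B i + 27) + 7 \<le> esize (xs i) * (B i + 27) + 7"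
        using length_less_esize[of "xs i"] by simp
      ultimately show "runs R [encode (i, xs i, s i)] (R ! k) (encode (fold (f i) (xs i) (s i)))
          (esize (xs i) * (B i + 27) + 7)"
        using runs_mono[OF runs_append_program[OF loop[of i]]] by (simp only: R_def)
    qed
    then show "computes R (Call k (shift_calls (length P') e')) (\<lambda>i. fold (f i) (xs i) (s i))
        (\<lambda>i. \<tau>' i + (esize (xs i) * (B i + 27) + 7) + 1)"
      unfolding computes_def by blast
  qed
qed

section \<open>List operations as folds\<close>

lemma poly_time_rev [poly_time_intros]:
  assumes "poly_time xs"
  shows "poly_time (\<lambda>i. rev (xs i))"
proof -
  have "poly_time (\<lambda>i. fold (\<lambda>a t. a # t) (xs i) [])"
    by (rule poly_time_fold[where q = "\<lambda>i. esize (xs i) + 1"])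
      (auto intro!: poly_time_intros assms poly_bounded_add poly_bounded_Suc poly_time_esize poly_bounded_const
        dest: esize_mem)
  then show ?thesis by (simp add: fold_Cons_rev)
qed

lemma poly_time_append [poly_time_intros]:
  assumes "poly_time xs" "poly_time ys"
  shows "poly_time (\<lambda>i. xs i @ ys i)"
proof -
  have "poly_time (\<lambda>i. fold (\<lambda>a t. a # t) (rev (xs i)) (ys i))"
    by (rule poly_time_fold[where q = "\<lambda>i. esize (xs i) + 1"])
      (auto intro!: poly_time_intros assms poly_bounded_add poly_bounded_Suc poly_time_esize poly_bounded_const
        dest: esize_mem)
  then show ?thesis by (simp add: fold_Cons_rev)
qed

text \<open>The size of each image is polynomial in the context and one element, and no element is
  larger than the list; hence one bound on the growth serves for all iterations.\<close>

lemma poly_time_map [poly_time_intros]: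
  assumes f: "poly_time (\<lambda>u. f (fst u) (snd u))" and xs: "poly_time xs"
  shows "poly_time (\<lambda>i. map (f i) (xs i))"
proof -
  obtain C d where C: "\<And>i a. esize (f i a) \<le> C * (esize i + esize a + 1) ^ d"
    using poly_time_esize[OF f] unfolding poly_bounded_def by (metis esize_simps(1) fst_conv snd_conv)
  have "poly_time (\<lambda>i. fold (\<lambda>a t. f i a # t) (rev (xs i)) [])"
  proof (rule poly_time_fold[where q = "\<lambda>i. C * (esize i + esize (xs i) + 1) ^ d + 1"])
    show "poly_bounded (\<lambda>i. C * (esize i + esize (xs i) + 1) ^ d + 1)"
      by (intro poly_bounded_add poly_bounded_mult poly_bounded_power poly_bounded_const
          poly_bounded_esize poly_time_esize xs)
    show "poly_time (\<lambda>u. f (fst u) (fst (snd u)) # snd (snd u))"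
      by (intro poly_time_intros poly_time_compose2[OF f])
    fix i a and t :: "'c list" assume "a \<in> set (rev (xs i))"
    then have "C * (esize i + esize a + 1) ^ d \<le> C * (esize i + esize (xs i) + 1) ^ d"
      by (intro mult_le_mono2 power_mono) (auto dest: esize_mem)
    then show "esize (f i a # t) \<le> esize t + (C * (esize i + esize (xs i) + 1) ^ d + 1)"
      using C[of i a] unfolding esize_simps by linarith
  qed (intro poly_time_intros xs)+
  moreover have "fold (\<lambda>a t. g a # t) (rev zs) ys = map g zs @ ys" for g :: "'b \<Rightarrow> 'c" and zs ys
    by (induction zs arbitrary: ys) auto
  ultimately show ?thesis by simp
qed

lemma poly_time_filter [poly_time_intros]:
  assumes f: "poly_time (\<lambda>u. f (fst u) (snd u))" and xs: "poly_time xs"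
  shows "poly_time (\<lambda>i. filter (f i) (xs i))"
proof -
  have "poly_time (\<lambda>i. fold (\<lambda>a t. if f i a then a # t else t) (rev (xs i)) [])"
    by (rule poly_time_fold[where q = "\<lambda>i. esize (xs i) + 1"])
      (auto intro!: poly_time_intros poly_time_compose2[OF f] xs poly_bounded_add poly_bounded_Suc
        poly_time_esize poly_bounded_const dest: esize_mem)
  moreover have "fold (\<lambda>a t. if g a then a # t else t) (rev zs) ys = filter g zs @ ys"
    for g :: "'b \<Rightarrow> bool" and zs ys
    by (induction zs arbitrary: ys) auto
  ultimately show ?thesis by simp
qed

lemma poly_time_Bex [poly_time_intros]:
  assumes f: "poly_time (\<lambda>u. f (fst u) (snd u))" and xs: "poly_time xs"
  shows "poly_time (\<lambda>i. \<exists>a\<in>set (xs i). f i a)"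
proof -
  have "poly_time (\<lambda>i. fold (\<lambda>a t. f i a \<or> t) (xs i) False)"
    by (rule poly_time_fold[where q = "\<lambda>i. 0"])
      (auto intro!: poly_time_intros poly_time_compose2[OF f] xs poly_bounded_const)
  moreover have "fold (\<lambda>a t. g a \<or> t) zs b = ((\<exists>a\<in>set zs. g a) \<or> b)" for g :: "'b \<Rightarrow> bool" and zs b
    by (induction zs arbitrary: b) auto
  ultimately show ?thesis by simp
qed

lemma poly_time_mem [poly_time_intros]:
  fixes f :: "'a::encodable \<Rightarrow> nat"
  assumes "poly_time f" "poly_time xs"
  shows "poly_time (\<lambda>i. f i \<in> set (xs i))"
proof -
  have "poly_time (\<lambda>i. \<exists>a\<in>set (xs i). a = f i)"
    by (intro poly_time_intros poly_time_compose[OF assms(1)] assms)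
  then show ?thesis by simp
qed

lemma poly_time_sum_list [poly_time_intros]:
  fixes f :: "'a::encodable \<Rightarrow> 'b::encodable \<Rightarrow> real"
  assumes f: "poly_time (\<lambda>u. f (fst u) (snd u))" and xs: "poly_time xs"
  shows "poly_time (\<lambda>i. \<Sum>a\<leftarrow>xs i. f i a)"
proof -
  have "poly_time (\<lambda>i. fold (\<lambda>a t. f i a + t) (xs i) 0)"
    by (rule poly_time_fold[where q = "\<lambda>i. 0"])
      (auto intro!: poly_time_intros poly_time_compose2[OF f] xs poly_bounded_const)
  moreover have "fold (\<lambda>a t. g a + t) zs b = (\<Sum>a\<leftarrow>zs. g a) + b" for g :: "'b \<Rightarrow> real" and zs b
    by (induction zs arbitrary: b) auto
  ultimately show ?thesis by simp
qed

lemma poly_time_program: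
  assumes "poly_time f"
  obtains P :: program and C d :: nat where
    "\<And>x. \<exists>t. eval P [encode x] (Call 0 (Var 0)) (encode (f x)) t \<and> t \<le> C * esize x ^ d"
proof -
  obtain P e \<tau> where \<tau>: "poly_bounded \<tau>" and e: "computes P e f \<tau>"
    using assms by (rule poly_timeE)
  have "poly_bounded (\<lambda>x. 1 + \<tau> x + 1)" by (intro poly_bounded_add \<tau> poly_bounded_const)
  then obtain C d where C: "\<And>x. 1 + \<tau> x + 1 \<le> C * esize x ^ d"
    unfolding poly_bounded_def by blast
  \<comment> \<open>The prescribed entry point is \<open>Call 0 (Var 0)\<close>: the expression
    itself becomes function 0, and all other functions move up by one.\<close>
  define Q where "Q = [shift_calls 1 e] @ map (shift_calls 1) P"
  have "runs Q [encode x] (Call 0 (Var 0)) (encode (f x)) (1 + \<tau> x + 1)" for x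
  proof (rule runs_Call)
    show "runs Q [encode x] (Var 0) (encode x) 1" by (rule runs_Var) auto
    show "runs Q [encode x] (Q ! 0) (encode (f x)) (\<tau> x)"
      using computes_shift[OF e, of "[shift_calls 1 e]"] unfolding computes_def Q_def by simp
  qed (simp add: Q_def)
  then show ?thesis using C that[of Q C d] unfolding runs_def by (meson order_trans)
qed

section \<open>The algorithm\<close>

lemma poly_time_eq_pair [poly_time_intros]:
  fixes f g :: "'a::encodable \<Rightarrow> nat \<times> nat"
  assumes "poly_time f" "poly_time g"
  shows "poly_time (\<lambda>x. f x = g x)"
  unfolding prod_eq_iff by (intro poly_time_intros assms)

text \<open>One relaxation pass over the edges. Vertices may be listed repeatedly; an edge adds at
  most 2 to the size, so the growth stays additive.\<close>

definition extend :: "(nat \<times> nat) list \<Rightarrow> nat list \<Rightarrow> nat list" where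
  "extend = fold (\<lambda>e S. if fst e \<in> set S then snd e # S
                        else if snd e \<in> set S then fst e # S else S)"

text \<open>Loops are available as folds over lists, so the list \<open>es @ es\<close> acts as a
  counter of passes and its entries are ignored.\<close>

definition reach :: "(nat \<times> nat) list \<Rightarrow> nat \<Rightarrow> nat list" where
  "reach es r = fold (\<lambda>_. extend es) (es @ es) [r]"

text \<open>The state of the algorithm lists the edges with their residual weights; the bought edges
  are those of residual weight 0.\<close>

type_synonym state = "(nat \<times> nat \<times> real) list"

definition ends :: "nat \<times> nat \<times> real \<Rightarrow> nat \<times> nat" where
  "ends e = (fst e, fst (snd e))"

definition bought :: "state \<Rightarrow> (nat \<times> nat) list" where
  "bought s = map ends (filter (\<lambda>e. snd (snd e) = 0) s)"

text \<open>Here \<open>S\<close> is the set of vertices connected to the root \<open>r\<close> by the bought edges. In a tree, the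
  incidences counted are those that \<open>e\<close> separates from \<open>r\<close>.\<close>

definition load ::
  "(nat \<times> nat) list \<Rightarrow> nat list \<Rightarrow> nat \<Rightarrow> nat list list \<Rightarrow> nat \<times> nat \<Rightarrow> real" where
  "load es S r gs e = (if (fst e \<in> set S) = (snd e \<in> set S) then 0
     else \<Sum>g\<leftarrow>gs. \<Sum>v\<leftarrow>g. if v \<in> set (reach (filter (\<lambda>e'. e' \<noteq> e) es) r) then 0 else 1)"

definition hits :: "nat list \<Rightarrow> nat list list \<Rightarrow> real" where
  "hits S gs = (\<Sum>g\<leftarrow>gs. if \<exists>v\<in>set g. v \<in> set S then 1 else 0)"

text \<open>The inner fold returns the last entry, which provides a start value from the list
  itself; the 0 surfaces only for the empty list.\<close>

definition least :: "real list \<Rightarrow> real" where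
  "least xs = fold (\<lambda>y m. if y < m then y else m) xs (fold (\<lambda>y m. y) xs 0)"

text \<open>A ratio test as in the simplex method: for nonnegative residuals and some positive load,
  this is the longest step that keeps every residual nonnegative.\<close>

definition step_length :: "(nat \<times> nat \<Rightarrow> real) \<Rightarrow> state \<Rightarrow> real" where
  "step_length l s = least (map (\<lambda>e. snd (snd e) / l (ends e)) (filter (\<lambda>e. 0 < l (ends e)) s))"

definition lower :: "real \<Rightarrow> (nat \<times> nat \<Rightarrow> real) \<Rightarrow> state \<Rightarrow> state" where
  "lower \<theta> l = map (\<lambda>e. (fst e, fst (snd e), snd (snd e) - \<theta> * l (ends e)))"

definition charge_round :: "real \<Rightarrow> nat \<Rightarrow> nat \<times> nat list list \<Rightarrow> state \<Rightarrow> state" where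
  "charge_round \<epsilon> r R s = (if (1 - \<epsilon>) * real (fst R) \<le> hits (reach (bought s) r) (snd R) then s
     else lower (step_length (load (map ends s) (reach (bought s) r) r (snd R)) s)
            (load (map ends s) (reach (bought s) r) r (snd R)) s)"

text \<open>Every round that charges buys an edge, so as many rounds as there are edges suffice.\<close>

definition serve :: "real \<Rightarrow> nat \<Rightarrow> nat \<times> nat list list \<Rightarrow> state \<Rightarrow> state" where
  "serve \<epsilon> r R s = fold (\<lambda>_. charge_round \<epsilon> r R) s s"

definition serve_all :: "real \<Rightarrow> nat \<Rightarrow> (nat \<times> nat list list) list \<Rightarrow> state \<Rightarrow> state" where
  "serve_all \<epsilon> r = fold (serve \<epsilon> r)"

text \<open>Nested so that \<open>encode\<close> of such a value is literally
  \<open>enc_input\<close>.\<close>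

type_synonym online_input =
  "real \<times> (nat list \<times> state) \<times> nat \<times> (nat \<times> nat list list) list"

text \<open>An online algorithm is a function of the revealed prefix and keeps no memory, so all
  requests so far are replayed from the original weights.\<close>

definition steiner :: "online_input \<Rightarrow> (nat \<times> nat) list" where
  "steiner x = bought (serve_all (fst x) (fst (snd (snd x))) (snd (snd (snd x)))
     (snd (fst (snd x))))"

section \<open>Sizes and running times of the components\<close>

lemma esize_extend: "esize (extend es S) \<le> esize S + 2 * length es"
proof (induction es arbitrary: S)
  case (Cons e es)
  define S' where "S' = (if fst e \<in> set S then snd e # S
      else if snd e \<in> set S then fst e # S else S)"
  have "extend (e # es) S = extend es S'" by (simp add: extend_def S'_def)
  moreover have "esize S' \<le> esize S + 2" by (simp add: S'_def)
  ultimately show ?case using Cons[of S'] by simp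
qed (simp add: extend_def)

text \<open>A real number has size 1 whatever its value. Rounds and requests therefore leave the
  size of the state unchanged, and their folds grow by 0.\<close>

lemma esize_lower: "esize (lower \<theta> l s) = esize s"
  by (induction s) (auto simp: lower_def)

lemma esize_charge_round: "esize (charge_round \<epsilon> r R s) = esize s"
  by (simp add: charge_round_def esize_lower)

lemma esize_serve: "esize (serve \<epsilon> r R s) = esize s"
proof -
  have "esize (fold (\<lambda>_. charge_round \<epsilon> r R) xs t) = esize t" for xs :: state and t
    by (induction xs arbitrary: t) (auto simp: esize_charge_round)
  then show ?thesis by (simp add: serve_def)
qed

lemma poly_time_extend [poly_time_intros]:
  assumes "poly_time es" "poly_time S"
  shows "poly_time (\<lambda>x. extend (es x) (S x))"
  unfolding extend_def
  by (rule poly_time_fold[where q = "\<lambda>_. 2"])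
    (auto intro!: poly_time_intros assms poly_bounded_const)

lemma poly_time_reach [poly_time_intros]:
  assumes "poly_time es" "poly_time r"
  shows "poly_time (\<lambda>x. reach (es x) (r x))"
  unfolding reach_def
proof (rule poly_time_fold[where q = "\<lambda>x. 2 * esize (es x)"])
  show "poly_bounded (\<lambda>x. 2 * esize (es x))"
    by (intro poly_bounded_mult poly_bounded_const poly_time_esize assms)
  show "esize (extend (es x) S) \<le> esize S + 2 * esize (es x)" for x S
    using esize_extend[of "es x" S] length_less_esize[of "es x"] by linarith
qed (intro poly_time_intros assms[THEN poly_time_compose])+

lemma poly_time_ends [poly_time_intros]:
  assumes "poly_time e" shows "poly_time (\<lambda>x. ends (e x))"
  unfolding ends_def by (intro poly_time_intros assms)

lemma poly_time_bought [poly_time_intros]: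
  assumes "poly_time s" shows "poly_time (\<lambda>x. bought (s x))"
  unfolding bought_def by (intro poly_time_intros assms)

lemma poly_time_load [poly_time_intros]:
  assumes "poly_time es" "poly_time S" "poly_time r" "poly_time gs" "poly_time e"
  shows "poly_time (\<lambda>x. load (es x) (S x) (r x) (gs x) (e x))"
  unfolding load_def by (intro poly_time_intros assms[THEN poly_time_compose])

lemma poly_time_hits [poly_time_intros]:
  assumes "poly_time S" "poly_time gs"
  shows "poly_time (\<lambda>x. hits (S x) (gs x))"
  unfolding hits_def by (intro poly_time_intros assms[THEN poly_time_compose])

lemma poly_time_least [poly_time_intros]:
  assumes "poly_time xs" shows "poly_time (\<lambda>x. least (xs x))"
  unfolding least_def
  by (intro poly_time_fold[where q = "\<lambda>_. 0"]) (auto intro!: poly_time_intros assms poly_bounded_const)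

lemma poly_time_step_length [poly_time_intros]:
  assumes "poly_time (\<lambda>u. l (fst u) (snd u))" "poly_time s"
  shows "poly_time (\<lambda>x. step_length (l x) (s x))"
  unfolding step_length_def
  by (intro poly_time_intros poly_time_compose2[OF assms(1)] assms(2))

lemma poly_time_lower [poly_time_intros]:
  assumes "poly_time \<theta>" "poly_time (\<lambda>u. l (fst u) (snd u))" "poly_time s"
  shows "poly_time (\<lambda>x. lower (\<theta> x) (l x) (s x))"
  unfolding lower_def
  by (intro poly_time_intros poly_time_compose2[OF assms(2)] assms(3) assms(1)[THEN poly_time_compose])

lemma poly_time_charge_round [poly_time_intros]:
  assumes "poly_time \<epsilon>" "poly_time r" "poly_time R" "poly_time s"
  shows "poly_time (\<lambda>x. charge_round (\<epsilon> x) (r x) (R x) (s x))"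
  unfolding charge_round_def by (intro poly_time_intros assms[THEN poly_time_compose])

lemma poly_time_serve [poly_time_intros]:
  assumes "poly_time \<epsilon>" "poly_time r" "poly_time R" "poly_time s"
  shows "poly_time (\<lambda>x. serve (\<epsilon> x) (r x) (R x) (s x))"
  unfolding serve_def
  by (rule poly_time_fold[where q = "\<lambda>_. 0"])
    (auto simp: esize_charge_round intro!: poly_time_intros assms[THEN poly_time_compose] poly_bounded_const)

lemma poly_time_serve_all [poly_time_intros]:
  assumes "poly_time \<epsilon>" "poly_time r" "poly_time \<sigma>" "poly_time s"
  shows "poly_time (\<lambda>x. serve_all (\<epsilon> x) (r x) (\<sigma> x) (s x))"
  unfolding serve_all_def
  by (rule poly_time_fold[where q = "\<lambda>_. 0"])
    (auto simp: esize_serve intro!: poly_time_intros assms[THEN poly_time_compose] poly_bounded_const)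

lemma poly_time_steiner: "poly_time steiner"
  unfolding steiner_def[abs_def] by (intro poly_time_intros)

section \<open>Cuts in trees\<close>

lemma connected_by_refl: "connected_by F x x"
  by (simp add: connected_by_def)

lemma connected_by_trans: "connected_by F x y \<Longrightarrow> connected_by F y z \<Longrightarrow> connected_by F x z"
  unfolding connected_by_def by (rule rtrancl_trans)

lemma connected_by_edge: "{x, y} \<in> F \<Longrightarrow> connected_by F x y"
  unfolding connected_by_def by (rule r_into_rtrancl) simp

lemma connected_by_sym: "connected_by F x y \<Longrightarrow> connected_by F y x"
proof -
  have "sym ({(a, b). {a, b} \<in> F}\<^sup>*)"
    by (rule sym_rtrancl) (auto simp: sym_def insert_commute)
  then show "connected_by F x y \<Longrightarrow> connected_by F y x"
    unfolding connected_by_def by (rule symD)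
qed

lemma connected_by_mono: "F \<subseteq> F' \<Longrightarrow> connected_by F x y \<Longrightarrow> connected_by F' x y"
  unfolding connected_by_def by (erule rtrancl_mono[THEN subsetD, rotated]) auto

text \<open>When a new first vertex already occurs on the path, the path is cut to start
  there.\<close>

lemma rtrancl_distinct_path:
  assumes "(x, y) \<in> R\<^sup>*"
  shows "\<exists>xs. xs \<noteq> [] \<and> hd xs = x \<and> last xs = y \<and> distinct xs \<and> successively (\<lambda>a b. (a, b) \<in> R) xs"
  using assms
proof (induction rule: converse_rtrancl_induct)
  case base
  show ?case by (rule exI[of _ "[y]"]) simp
next
  case (step x z)
  then obtain xs where xs: "xs \<noteq> []" "hd xs = z" "last xs = y" "distinct xs"
    "successively (\<lambda>a b. (a, b) \<in> R) xs" by blast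
  show ?case
  proof (cases "x \<in> set xs")
    case True
    then obtain ys zs where "xs = ys @ x # zs" by (meson split_list)
    then show ?thesis using xs
      by (intro exI[of _ "x # zs"]) (auto simp: successively_append_iff)
  next
    case False
    then show ?thesis using xs step.hyps(1)
      by (intro exI[of _ "x # xs"]) (auto simp: successively_Cons)
  qed
qed

text \<open>A simple path between the ends that avoids the edge would close with it to a cycle. The
  length 3 demanded of a cycle is reached because \<open>a \<noteq> b\<close> excludes one vertex
  and the deletion of the edge excludes two.\<close>

lemma acyclic_edge_separates:
  assumes "\<nexists>xs. is_cycle F xs" "{a, b} \<in> F" "a \<noteq> b"
  shows "\<not> connected_by (F - {{a, b}}) a b"
proof
  assume "connected_by (F - {{a, b}}) a b"
  then obtain xs where xs: "xs \<noteq> []" "hd xs = a" "last xs = b" "distinct xs"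
    and suc: "successively (\<lambda>x y. {x, y} \<in> F - {{a, b}}) xs"
    unfolding connected_by_def by (auto dest: rtrancl_distinct_path)
  have nth: "{xs ! i, xs ! Suc i} \<in> F - {{a, b}}" if "Suc i < length xs" for i
    using suc that by (auto simp: successively_conv_nth)
  have hd: "xs ! 0 = a" and last: "xs ! (length xs - 1) = b"
    using xs by (auto simp: hd_conv_nth last_conv_nth)
  have "length xs \<noteq> 1" using hd last assms(3) by auto
  moreover have "length xs \<noteq> 2" using nth[of 0] hd last by auto
  ultimately have len: "3 \<le> length xs" using xs(1) by (cases xs) (auto simp: neq_Nil_conv)
  have "{xs ! i, xs ! (Suc i mod length xs)} \<in> F" if "i < length xs" for i
  proof (cases "Suc i = length xs")
    case True
    then have "i = length xs - 1" by simp
    then have "{xs ! i, xs ! (Suc i mod length xs)} = {b, a}" using hd last True by simp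
    then show ?thesis using assms(2) by (simp add: insert_commute)
  next
    case False
    then show ?thesis using nth[of i] that by simp
  qed
  then have "is_cycle F xs" using len xs(4) by (simp add: is_cycle_def)
  then show False using assms(1) by blast
qed

text \<open>Takes the last exit from \<open>S\<close>, so that the remainder of the path stays
  outside.\<close>

lemma path_leaves_set:
  assumes "(x, y) \<in> R\<^sup>*" "x \<in> S" "y \<notin> S"
  shows "\<exists>a b. (x, a) \<in> R\<^sup>* \<and> (a, b) \<in> R \<and> a \<in> S \<and> b \<notin> S \<and> (b, y) \<in> (R \<inter> (- S) \<times> (- S))\<^sup>*"
  using assms
proof (induction rule: rtrancl_induct)
  case base
  then show ?case by blast
next
  case (step y z)
  show ?case
  proof (cases "y \<in> S")
    case True
    then show ?thesis using step by blast
  next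
    case False
    then obtain a b where ab: "(x, a) \<in> R\<^sup>*" "(a, b) \<in> R" "a \<in> S" "b \<notin> S"
      "(b, y) \<in> (R \<inter> (- S) \<times> (- S))\<^sup>*" using step by blast
    have "(y, z) \<in> R \<inter> (- S) \<times> (- S)" using step False by blast
    then show ?thesis using ab by (blast intro: rtrancl_into_rtrancl)
  qed
qed

section \<open>Correctness of the reachability search\<close>

definition edge_of :: "nat \<times> nat \<Rightarrow> nat set" where
  "edge_of p = {fst p, snd p}"

definition edge_set :: "(nat \<times> nat) list \<Rightarrow> nat set set" where
  "edge_set ps = edge_of ` set ps"

lemma set_extend_subset:
  assumes "edge_set es \<subseteq> F" "set S \<subseteq> {v. connected_by F r v}"
  shows "set (extend es S) \<subseteq> {v. connected_by F r v}"
  using assms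
proof (induction es arbitrary: S)
  case (Cons e es)
  define S' where "S' = (if fst e \<in> set S then snd e # S
      else if snd e \<in> set S then fst e # S else S)"
  have "{fst e, snd e} \<in> F" using Cons.prems(1) by (auto simp: edge_set_def edge_of_def)
  then have e: "connected_by F (fst e) (snd e)" "connected_by F (snd e) (fst e)"
    by (auto intro: connected_by_edge connected_by_sym)
  have "set S' \<subseteq> {v. connected_by F r v}"
    using Cons.prems(2) e connected_by_trans[of F r] by (auto simp: S'_def)
  moreover have "extend (e # es) S = extend es S'" by (simp add: extend_def S'_def)
  ultimately show ?case using Cons.IH[of S'] Cons.prems(1) by (simp add: edge_set_def)
qed (simp add: extend_def)

lemma set_subset_extend: "set S \<subseteq> set (extend es S)"
proof (induction es arbitrary: S)
  case (Cons e es)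
  define S' where "S' = (if fst e \<in> set S then snd e # S
      else if snd e \<in> set S then fst e # S else S)"
  have "extend (e # es) S = extend es S'" by (simp add: extend_def S'_def)
  moreover have "set S \<subseteq> set S'" by (auto simp: S'_def)
  ultimately show ?case using Cons.IH[of S'] by auto
qed (simp add: extend_def)

lemma extend_neighbour:
  assumes "e \<in> set es" "edge_of e = {a, b}" "a \<in> set S"
  shows "b \<in> set (extend es S)"
  using assms
proof (induction es arbitrary: S)
  case (Cons e' es)
  define S' where "S' = (if fst e' \<in> set S then snd e' # S
      else if snd e' \<in> set S then fst e' # S else S)"
  have ext: "extend (e' # es) S = extend es S'" by (simp add: extend_def S'_def)
  show ?case
  proof (cases "e = e'")
    case True
    then have "b \<in> set S'" using Cons.prems by (auto simp: S'_def edge_of_def doubleton_eq_iff)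
    then show ?thesis using set_subset_extend ext by auto
  next
    case False
    have "a \<in> set S'" using Cons.prems by (auto simp: S'_def)
    then show ?thesis using False Cons ext by auto
  qed
qed simp

text \<open>A path that visits no edge twice in the same direction has at most \<open>2 * length es\<close> edges, so
  the passes over \<open>es @ es\<close> are enough.\<close>

lemma set_reach: "set (reach es r) = {v. connected_by (edge_set es) r v}"
proof
  let ?R = "{(a, b). {a, b} \<in> edge_set es}"
  have "set (fold (\<lambda>_. extend es) ys S) \<subseteq> {v. connected_by (edge_set es) r v}"
    if "set S \<subseteq> {v. connected_by (edge_set es) r v}" for ys :: "(nat \<times> nat) list" and S
    using that by (induction ys arbitrary: S) (auto simp: set_extend_subset)
  then show "set (reach es r) \<subseteq> {v. connected_by (edge_set es) r v}"
    unfolding reach_def by (simp add: connected_by_refl)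
  have R: "?R = set es \<union> (set es)\<inverse>"
    by (auto simp: edge_set_def edge_of_def doubleton_eq_iff image_iff; force)
  have fold_mono: "set S \<subseteq> set (fold (\<lambda>_. extend es) ys S)" for ys :: "(nat \<times> nat) list" and S
    by (induction ys arbitrary: S) (auto dest: set_subset_extend[THEN subsetD])
  \<comment> \<open>A pass reaches at least the next vertex of a path, so peeling off the first edge
    uses up one entry of the counter \<open>ys\<close>.\<close>
  have relpow: "v \<in> set (fold (\<lambda>_. extend es) ys S)"
    if "(u, v) \<in> ?R ^^ n" "n \<le> length ys" "u \<in> set S" for u v n and ys :: "(nat \<times> nat) list" and S
    using that
  proof (induction n arbitrary: u S ys)
    case 0
    then show ?case using fold_mono by auto
  next
    case (Suc n)
    obtain y ys' where ys: "ys = y # ys'" using Suc.prems(2) by (cases ys) auto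
    obtain x where x: "{u, x} \<in> edge_set es" "(x, v) \<in> ?R ^^ n"
      using relpow_Suc_D2[OF Suc.prems(1)] by auto
    then have "x \<in> set (extend es S)"
      using extend_neighbour Suc.prems(3) unfolding edge_set_def by (metis imageE)
    then show ?case using Suc.IH[OF x(2), of ys' "extend es S"] Suc.prems(2) by (simp add: ys)
  qed
  have "card ?R \<le> length (es @ es)"
  proof -
    have "card ?R \<le> card (set es) + card ((set es)\<inverse>)" unfolding R by (rule card_Un_le)
    also have "\<dots> \<le> length (es @ es)" using card_length[of es] by simp
    finally show ?thesis .
  qed
  moreover have "finite ?R" unfolding R by simp
  ultimately show "{v. connected_by (edge_set es) r v} \<subseteq> set (reach es r)"
    unfolding connected_by_def reach_def using relpow[of r _ _ "es @ es" "[r]"]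
    by (auto simp: rtrancl_finite_eq_relpow simp del: length_append)
qed


section \<open>One round of the algorithm\<close>

lemma sum_sum_list: "(\<Sum>e\<in>E. \<Sum>x\<leftarrow>xs. f e x) = (\<Sum>x\<leftarrow>xs. \<Sum>e\<in>E. f e x :: real)"
  by (induction xs) (simp_all add: sum.distrib)

lemma least_mem: "xs \<noteq> [] \<Longrightarrow> least xs \<in> set xs"
  and least_le: "x \<in> set xs \<Longrightarrow> least xs \<le> x"
proof -
  have last: "fold (\<lambda>y m. y) xs z = last xs" if "xs \<noteq> []" for z and xs :: "real list"
    using that by (induction xs arbitrary: z) auto
  have "fold (\<lambda>y m. if y < m then y else m) ys z \<in> insert z (set ys) \<and>
      (\<forall>x\<in>insert z (set ys). fold (\<lambda>y m. if y < m then y else m) ys z \<le> x)"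
    for ys and z :: real
  proof (induction ys arbitrary: z)
    case (Cons y ys)
    show ?case using Cons[of y] Cons[of z] by (cases "y < z") auto
  qed simp
  from this[of xs "last xs"] last[of xs]
  show "xs \<noteq> [] \<Longrightarrow> least xs \<in> set xs" and "x \<in> set xs \<Longrightarrow> least xs \<le> x"
    unfolding least_def by (cases xs; auto)+
qed

text \<open>Residual weights are kept here as a function on edges instead of a list of triples.\<close>

definition state_of :: "(nat \<times> nat) list \<Rightarrow> (nat set \<Rightarrow> real) \<Rightarrow> state" where
  "state_of es c = map (\<lambda>p. (fst p, snd p, c (edge_of p))) es"

definition hit_count :: "nat set \<Rightarrow> nat list list \<Rightarrow> real" where
  "hit_count U gs = (\<Sum>g\<leftarrow>gs. of_bool (set g \<inter> U \<noteq> {}))"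

text \<open>The cut arguments work with \<open>E\<close>, the program with \<open>es\<close>. By
  \<open>ordered\<close>, distinct pairs are distinct edges, so filtering out a pair deletes exactly
  one edge.\<close>

locale rooted_tree =
  fixes V :: "nat set" and E :: "nat set set" and r :: nat and es :: "(nat \<times> nat) list"
  assumes tree: "is_tree V E" and root: "r \<in> V"
    and es: "edge_set es = E" and ordered: "p \<in> set es \<Longrightarrow> fst p < snd p"
begin

definition conn :: "(nat set \<Rightarrow> real) \<Rightarrow> nat set" where
  "conn c = {v. connected_by {e \<in> E. c e = 0} r v}"

text \<open>In the tree, the last conjunct places \<open>e\<close> on the path from \<open>r\<close>
  to \<open>v\<close>; the first two say that this path leaves \<open>conn c\<close> through
  \<open>e\<close>.\<close>

definition frontier_cut :: "(nat set \<Rightarrow> real) \<Rightarrow> nat set \<Rightarrow> nat \<Rightarrow> bool" where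
  "frontier_cut c e v \<longleftrightarrow> e \<inter> conn c \<noteq> {} \<and> \<not> e \<subseteq> conn c \<and> \<not> connected_by (E - {e}) r v"

definition edge_load :: "(nat set \<Rightarrow> real) \<Rightarrow> nat list list \<Rightarrow> nat set \<Rightarrow> real" where
  "edge_load c gs e = (\<Sum>g\<leftarrow>gs. \<Sum>v\<leftarrow>g. of_bool (frontier_cut c e v))"

lemma finite_E: "finite E"
  using es by (auto simp: edge_set_def)

lemma reachable: "v \<in> V \<Longrightarrow> connected_by E r v"
  using tree root by (simp add: is_tree_def)

lemma edge_doubleton:
  assumes "e \<in> E" obtains a b where "e = {a, b}" "a \<noteq> b"
proof -
  have "card e = 2" using assms tree by (simp add: is_tree_def is_graph_def)
  then show ?thesis using that by (auto simp: card_2_iff)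
qed

lemma conn_closed:
  assumes "e \<in> E" "c e = 0" shows "e \<inter> conn c = {} \<or> e \<subseteq> conn c"
proof -
  obtain a b where e: "e = {a, b}" using assms edge_doubleton by metis
  then have "connected_by {e \<in> E. c e = 0} a b" "connected_by {e \<in> E. c e = 0} b a"
    using assms by (auto intro!: connected_by_edge simp: insert_commute)
  then have "a \<in> conn c \<longleftrightarrow> b \<in> conn c" unfolding conn_def using connected_by_trans by blast
  then show ?thesis unfolding e by auto
qed

lemma frontier_cut_residual: "e \<in> E \<Longrightarrow> frontier_cut c e v \<Longrightarrow> c e \<noteq> 0"
  unfolding frontier_cut_def using conn_closed by blast

lemma frontier_cut_imp_notin_conn:
  assumes "e \<in> E" "frontier_cut c e v" shows "v \<notin> conn c"
proof
  assume "v \<in> conn c"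
  moreover have "{e \<in> E. c e = 0} \<subseteq> E - {e}" using frontier_cut_residual[OF assms] by auto
  ultimately have "connected_by (E - {e}) r v" unfolding conn_def
    using connected_by_mono[of "{e \<in> E. c e = 0}" "E - {e}"] by blast
  then show False using assms(2) by (simp add: frontier_cut_def)
qed

text \<open>The candidate is the last exit \<open>{a, b}\<close> of the path from
  \<open>conn c\<close>. If \<open>v\<close> were reachable without it, its ends would be connected
  around it, against acyclicity. Any other frontier edge is avoided by going to \<open>a\<close>
  along bought edges, over \<open>{a, b}\<close>, and on outside \<open>conn c\<close>.\<close>

lemma ex1_frontier_cut:
  assumes v: "v \<in> V" "v \<notin> conn c"
  shows "\<exists>!e. e \<in> E \<and> frontier_cut c e v"
proof -
  let ?S = "conn c" and ?R = "{(a, b). {a, b} \<in> E}"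
  have "r \<in> ?S" by (simp add: conn_def connected_by_refl)
  then obtain a b where ab: "{a, b} \<in> E" "a \<in> ?S" "b \<notin> ?S"
    and rest: "(b, v) \<in> (?R \<inter> (- ?S) \<times> (- ?S))\<^sup>*"
    using path_leaves_set[OF reachable[OF v(1), unfolded connected_by_def] _ v(2)] by auto
  \<comment> \<open>After the last exit, no edge touches \<open>conn c\<close>.\<close>
  have outside: "connected_by (E - {e}) b v" if "e \<inter> ?S \<noteq> {}" for e
    unfolding connected_by_def
    by (rule rtrancl_mono[THEN subsetD, OF _ rest]) (use that in auto)
  \<comment> \<open>An edge that leaves \<open>conn c\<close> is not bought, so its deletion
    disconnects nothing within \<open>conn c\<close>.\<close>
  have inside: "connected_by (E - {e}) r x" if "e \<in> E" "e \<inter> ?S \<noteq> {}" "\<not> e \<subseteq> ?S" "x \<in> ?S" for e x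
  proof -
    have "c e \<noteq> 0" using conn_closed[OF that(1)] that(2,3) by auto
    then show ?thesis using that(4) unfolding conn_def
      by (intro connected_by_mono[of "{e \<in> E. c e = 0}" "E - {e}"]) auto
  qed
  have "a \<noteq> b" using ab by auto
  have "frontier_cut c {a, b} v"
    unfolding frontier_cut_def
  proof (intro conjI notI)
    assume rv: "connected_by (E - {{a, b}}) r v"
    have "connected_by (E - {{a, b}}) a r"
      using inside[OF ab(1), of a] ab by (auto intro: connected_by_sym)
    moreover have "connected_by (E - {{a, b}}) v b"
      using outside[of "{a, b}"] ab by (auto intro: connected_by_sym)
    ultimately have "connected_by (E - {{a, b}}) a b" using rv by (meson connected_by_trans)
    moreover have "\<nexists>xs. is_cycle E xs" using tree by (simp add: is_tree_def)
    ultimately show False using acyclic_edge_separates ab(1) \<open>a \<noteq> b\<close> by blast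
  qed (use ab in auto)
  moreover have "e = {a, b}" if e: "e \<in> E" "frontier_cut c e v" for e
  proof (rule ccontr)
    assume ne: "e \<noteq> {a, b}"
    have cut: "e \<inter> ?S \<noteq> {}" "\<not> e \<subseteq> ?S" using e(2) by (auto simp: frontier_cut_def)
    have "connected_by (E - {e}) a b" using ab(1) ne by (auto intro: connected_by_edge)
    then have "connected_by (E - {e}) r v"
      using inside[OF e(1) cut ab(2)] outside[OF cut(1)] by (meson connected_by_trans)
    then show False using e(2) by (simp add: frontier_cut_def)
  qed
  ultimately show ?thesis using ab(1) by blast
qed

text \<open>The first part limits what an incidence can pay in total. In the second, the edge that
  cuts off \<open>v\<close> must belong to \<open>F\<close>, since otherwise \<open>F\<close> would
  connect \<open>r\<close> to \<open>v\<close> without it; so the whole unit is paid on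
  \<open>F\<close>.\<close>

lemma sum_frontier_cut:
  assumes "v \<in> V" "F \<subseteq> E"
  shows "(\<Sum>e\<in>F. of_bool (frontier_cut c e v)) \<le> (1 :: real)"
    and "connected_by F r v \<Longrightarrow> (\<Sum>e\<in>F. of_bool (frontier_cut c e v)) = (of_bool (v \<notin> conn c) :: real)"
proof -
  have fin: "finite F" using assms(2) finite_E finite_subset by blast
  have "(\<Sum>e\<in>F. of_bool (frontier_cut c e v)) \<le> (1 :: real) \<and>
    (connected_by F r v \<longrightarrow> (\<Sum>e\<in>F. of_bool (frontier_cut c e v)) = (of_bool (v \<notin> conn c) :: real))"
  proof (cases "v \<in> conn c")
    case True
    then have "\<not> frontier_cut c e v" if "e \<in> F" for e
      using frontier_cut_imp_notin_conn assms(2) that by blast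
    then show ?thesis using True by simp
  next
    case False
    obtain e where e: "e \<in> E" "frontier_cut c e v"
      and unique: "\<And>e'. e' \<in> E \<Longrightarrow> frontier_cut c e' v \<Longrightarrow> e' = e"
      using ex1_frontier_cut[OF assms(1) False] by blast
    have "frontier_cut c e' v \<longleftrightarrow> e' = e" if "e' \<in> F" for e'
      using that e(2) unique[of e'] assms(2) by blast
    then have "(\<Sum>e'\<in>F. of_bool (frontier_cut c e' v)) = (\<Sum>e'\<in>F. if e' = e then 1 else 0 :: real)"
      by (intro sum.cong) simp_all
    also have "\<dots> = of_bool (e \<in> F)" using fin by simp
    finally have "(\<Sum>e'\<in>F. of_bool (frontier_cut c e' v)) = (of_bool (e \<in> F) :: real)" .
    moreover have "e \<in> F" if "connected_by F r v"
      using that e(2) assms(2) connected_by_mono[of F "E - {e}"] unfolding frontier_cut_def by blast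
    ultimately show ?thesis using False by simp
  qed
  then show "(\<Sum>e\<in>F. of_bool (frontier_cut c e v)) \<le> (1 :: real)"
    and "connected_by F r v \<Longrightarrow> (\<Sum>e\<in>F. of_bool (frontier_cut c e v)) = (of_bool (v \<notin> conn c) :: real)"
    by auto
qed

section \<open>Upper and lower bounds on the load\<close>

lemma sum_edge_load:
  "(\<Sum>e\<in>F. edge_load c gs e) = (\<Sum>g\<leftarrow>gs. \<Sum>v\<leftarrow>g. \<Sum>e\<in>F. of_bool (frontier_cut c e v))"
  by (simp add: edge_load_def sum_sum_list)

lemma total_load_le:
  assumes "\<forall>g\<in>set gs. set g \<subseteq> V"
  shows "(\<Sum>e\<in>E. edge_load c gs e) \<le> real (\<Sum>g\<leftarrow>gs. length g)"
proof -
  have "(\<Sum>v\<leftarrow>g. \<Sum>e\<in>E. of_bool (frontier_cut c e v)) \<le> real (length g)" if "set g \<subseteq> V" for g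
    using that
  proof (induction g)
    case (Cons v g)
    then show ?case using sum_frontier_cut(1)[of v E c] by simp
  qed simp
  then have "(\<Sum>g\<leftarrow>gs. \<Sum>v\<leftarrow>g. \<Sum>e\<in>E. of_bool (frontier_cut c e v)) \<le> (\<Sum>g\<leftarrow>gs. real (length g))"
    using assms by (intro sum_list_mono) blast
  also have "\<dots> = real (\<Sum>g\<leftarrow>gs. length g)" by (induction gs) auto
  finally show ?thesis by (simp add: sum_edge_load)
qed

text \<open>A group that meets \<open>U\<close> but misses \<open>conn c\<close> contains a vertex
  of \<open>U\<close> outside \<open>conn c\<close>, whose unit falls entirely on \<open>F\<close>.
  Distinct groups contribute distinct incidences even if they share that vertex.\<close>

lemma load_ge_missed_groups:
  assumes F: "F \<subseteq> E" "\<And>v. v \<in> U \<Longrightarrow> connected_by F r v" and U: "U \<subseteq> V"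
  shows "hit_count U gs - hit_count (conn c) gs \<le> (\<Sum>e\<in>F. edge_load c gs e)"
proof -
  have "of_bool (set g \<inter> U \<noteq> {}) - of_bool (set g \<inter> conn c \<noteq> {})
      \<le> (\<Sum>v\<leftarrow>g. \<Sum>e\<in>F. of_bool (frontier_cut c e v) :: real)" for g
  proof (cases "set g \<inter> U \<noteq> {} \<and> set g \<inter> conn c = {}")
    case True
    then obtain v where v: "v \<in> set g" "v \<in> U" "v \<notin> conn c" by blast
    have "1 \<le> (\<Sum>e\<in>F. of_bool (frontier_cut c e v) :: real)"
      using sum_frontier_cut(2)[of v F c] v F U by auto
    also have "\<dots> \<le> (\<Sum>v\<leftarrow>g. \<Sum>e\<in>F. of_bool (frontier_cut c e v) :: real)"
      using v(1) by (intro member_le_sum_list) (auto intro: sum_nonneg)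
    finally show ?thesis using True by simp
  next
    case False
    have "0 \<le> (\<Sum>v\<leftarrow>g. \<Sum>e\<in>F. of_bool (frontier_cut c e v) :: real)"
      by (intro sum_list_nonneg) (auto intro: sum_nonneg)
    then show ?thesis using False by auto
  qed
  then have "(\<Sum>g\<leftarrow>gs. of_bool (set g \<inter> U \<noteq> {}) - of_bool (set g \<inter> conn c \<noteq> {}))
      \<le> (\<Sum>g\<leftarrow>gs. \<Sum>v\<leftarrow>g. \<Sum>e\<in>F. of_bool (frontier_cut c e v) :: real)"
    by (intro sum_list_mono) blast
  then show ?thesis by (simp add: sum_edge_load hit_count_def sum_list_subtractf)
qed

lemma edge_load_nonneg: "0 \<le> edge_load c gs e"
  unfolding edge_load_def by (auto intro!: sum_list_nonneg)

lemma edge_load_bought: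
  assumes "e \<in> E" "c e = 0" shows "edge_load c gs e = 0"
proof -
  have "\<not> frontier_cut c e v" for v using frontier_cut_residual assms by blast
  then show ?thesis by (simp add: edge_load_def)
qed

section \<open>The rounds of the program as charges on residual weights\<close>

definition step :: "(nat set \<Rightarrow> real) \<Rightarrow> nat list list \<Rightarrow> real" where
  "step c gs = step_length (\<lambda>p. edge_load c gs (edge_of p)) (state_of es c)"

definition satisfied :: "real \<Rightarrow> nat \<times> nat list list \<Rightarrow> (nat set \<Rightarrow> real) \<Rightarrow> bool" where
  "satisfied \<epsilon> R c \<longleftrightarrow> (1 - \<epsilon>) * real (fst R) \<le> hit_count (conn c) (snd R)"

definition charge :: "real \<Rightarrow> nat \<times> nat list list \<Rightarrow> (nat set \<Rightarrow> real) \<Rightarrow> nat set \<Rightarrow> real" where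
  "charge \<epsilon> R c =
    (if satisfied \<epsilon> R c then c else (\<lambda>e. c e - step c (snd R) * edge_load c (snd R) e))"

lemma edge_set_bought: "edge_set (bought (state_of es c)) = {e \<in> E. c e = 0}"
  unfolding es[symmetric]
  by (force simp: edge_set_def bought_def state_of_def ends_def edge_of_def filter_map o_def)

lemma map_ends_state_of: "map ends (state_of es c) = es"
  by (simp add: state_of_def o_def ends_def)

lemma edge_of_inject: "p \<in> set es \<Longrightarrow> q \<in> set es \<Longrightarrow> edge_of p = edge_of q \<Longrightarrow> p = q"
  using ordered[of p] ordered[of q] by (auto simp: edge_of_def doubleton_eq_iff prod_eq_iff)

lemma edge_set_filter:
  assumes "p \<in> set es" shows "edge_set (filter (\<lambda>q. q \<noteq> p) es) = E - {edge_of p}"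
  unfolding es[symmetric] edge_set_def
  using edge_of_inject[OF _ assms] by auto

lemma load_eq:
  assumes "p \<in> set es" "set S = conn c"
  shows "load es S r gs p = edge_load c gs (edge_of p)"
proof -
  have "(fst p \<in> conn c) = (snd p \<in> conn c) \<longleftrightarrow>
      \<not> (edge_of p \<inter> conn c \<noteq> {} \<and> \<not> edge_of p \<subseteq> conn c)"
    by (auto simp: edge_of_def)
  moreover have "(if v \<in> set (reach (filter (\<lambda>q. q \<noteq> p) es) r) then 0 else 1) =
      (of_bool (\<not> connected_by (E - {edge_of p}) r v) :: real)" for v
    by (simp add: set_reach edge_set_filter[OF assms(1)])
  ultimately show ?thesis
    unfolding load_def edge_load_def frontier_cut_def assms(2)
    by (cases "edge_of p \<inter> conn c = {}"; cases "edge_of p \<subseteq> conn c") simp_all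
qed

lemma hits_eq: "hits S gs = hit_count (set S) gs"
proof -
  have "(if \<exists>v\<in>set g. v \<in> set S then 1 else 0 :: real) = of_bool (set g \<inter> set S \<noteq> {})" for g
    by auto
  then show ?thesis unfolding hits_def hit_count_def by simp
qed

text \<open>The link between program and analysis: from here on, a round is an application of
  \<open>charge\<close>, and lists of triples can be forgotten.\<close>

lemma charge_round_state_of: "charge_round \<epsilon> r R (state_of es c) = state_of es (charge \<epsilon> R c)"
proof -
  let ?S = "reach (bought (state_of es c)) r"
  have S: "set ?S = conn c" by (simp add: set_reach edge_set_bought conn_def)
  have l: "load es ?S r gs (ends e) = edge_load c gs (edge_of (ends e))"
    if "e \<in> set (state_of es c)" for e gs
  proof -
    have "ends e \<in> set es" using that map_ends_state_of[of c] by (metis image_eqI set_map)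
    then show ?thesis using load_eq S by blast
  qed
  have step: "step_length (load es ?S r gs) (state_of es c) = step c gs" for gs
    unfolding step_def step_length_def
    by (intro arg_cong[of _ _ least] map_cong filter_cong) (auto simp: l)
  have "lower \<theta> (load es ?S r gs) (state_of es c) =
      state_of es (\<lambda>e. c e - \<theta> * edge_load c gs e)" for \<theta> gs
  proof -
    have "lower \<theta> (load es ?S r gs) (state_of es c) =
        map (\<lambda>e. (fst e, fst (snd e), snd (snd e) - \<theta> * edge_load c gs (edge_of (ends e))))
          (state_of es c)"
      unfolding lower_def by (rule map_cong) (simp_all add: l)
    then show ?thesis by (simp add: state_of_def ends_def o_def)
  qed
  then show ?thesis
    by (simp add: charge_round_def charge_def satisfied_def hits_eq S map_ends_state_of step)
qed

lemma step_properties: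
  assumes nonneg: "\<And>e. e \<in> E \<Longrightarrow> 0 \<le> c e" and pos: "e0 \<in> E" "0 < edge_load c gs e0"
  shows "0 \<le> step c gs" and "\<And>e. e \<in> E \<Longrightarrow> step c gs * edge_load c gs e \<le> c e"
    and "\<exists>e\<in>E. 0 < edge_load c gs e \<and> step c gs * edge_load c gs e = c e"
proof -
  let ?l = "edge_load c gs"
  define xs where "xs = map (\<lambda>e. snd (snd e) / ?l (edge_of (ends e)))
    (filter (\<lambda>e. 0 < ?l (edge_of (ends e))) (state_of es c))"
  have "set xs = (\<lambda>p. c (edge_of p) / ?l (edge_of p)) ` {p \<in> set es. 0 < ?l (edge_of p)}"
    unfolding xs_def state_of_def by (force simp: ends_def)
  then have xs: "set xs = (\<lambda>e. c e / ?l e) ` {e \<in> E. 0 < ?l e}"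
    unfolding es[symmetric] edge_set_def by force
  have step: "step c gs = least xs" by (simp add: step_def step_length_def xs_def)
  \<comment> \<open>Thanks to \<open>e0\<close> the minimum is an actual ratio and not the default
    0.\<close>
  have "xs \<noteq> []" using xs pos by auto
  then have "step c gs \<in> set xs" unfolding step by (rule least_mem)
  then obtain e where e: "e \<in> E" "0 < ?l e" "step c gs = c e / ?l e" unfolding xs by auto
  then show "0 \<le> step c gs" using nonneg by simp
  show "\<exists>e\<in>E. 0 < ?l e \<and> step c gs * ?l e = c e" using e by auto
  fix e assume e: "e \<in> E"
  show "step c gs * ?l e \<le> c e"
  proof (cases "0 < ?l e")
    case True
    then have "step c gs \<le> c e / ?l e" unfolding step using least_le xs e by blast
    then show ?thesis using True by (simp add: field_simps)
  next
    case False
    then have "?l e = 0" using edge_load_nonneg[of c gs e] by linarith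
    then show ?thesis using nonneg[OF e] by simp
  qed
qed

section \<open>Progress and cost of one round\<close>

definition admissible :: "nat \<times> nat list list \<Rightarrow> bool" where
  "admissible R \<longleftrightarrow> (\<forall>g\<in>set (snd R). set g \<subseteq> V) \<and> real (fst R) \<le> hit_count V (snd R)"

text \<open>The lower bound on the load, taken for the whole tree: its vertices hit at least
  \<open>f\<close> groups, while \<open>conn c\<close> hits fewer, so the total load is
  positive.\<close>

lemma exists_loaded_edge:
  assumes "admissible R" "0 < \<epsilon>" "\<not> satisfied \<epsilon> R c"
  obtains e where "e \<in> E" "0 < edge_load c (snd R) e"
proof -
  have "(1 - \<epsilon>) * real (fst R) \<le> real (fst R)"
    using mult_right_mono[of "1 - \<epsilon>" 1 "real (fst R)"] assms(2) by simp
  then have "0 < hit_count V (snd R) - hit_count (conn c) (snd R)"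
    using assms(1,3) by (simp add: admissible_def satisfied_def)
  also have "\<dots> \<le> (\<Sum>e\<in>E. edge_load c (snd R) e)"
    by (rule load_ge_missed_groups) (auto intro: reachable)
  finally have "\<exists>e\<in>E. 0 < edge_load c (snd R) e"
    by (metis linorder_not_less sum_nonpos)
  then show ?thesis using that by blast
qed

lemma charge_bounds:
  assumes "admissible R" "0 < \<epsilon>" "\<And>e. e \<in> E \<Longrightarrow> 0 \<le> c e" "e \<in> E"
  shows "0 \<le> charge \<epsilon> R c e" and "charge \<epsilon> R c e \<le> c e"
proof -
  have "0 \<le> charge \<epsilon> R c e \<and> charge \<epsilon> R c e \<le> c e"
  proof (cases "satisfied \<epsilon> R c")
    case False
    obtain e0 where "e0 \<in> E" "0 < edge_load c (snd R) e0"
      using exists_loaded_edge[OF assms(1,2) False] .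
    from step_properties[OF assms(3) this] show ?thesis
      using False assms(4) edge_load_nonneg by (simp add: charge_def)
  qed (use assms(3,4) in \<open>simp add: charge_def\<close>)
  then show "0 \<le> charge \<epsilon> R c e" and "charge \<epsilon> R c e \<le> c e" by auto
qed

text \<open>The edge attaining the minimum ratio drops to 0. It is new because bought edges carry no
  load, and no old one is lost because residuals stay between 0 and their former value.\<close>

lemma charge_buys:
  assumes "admissible R" "0 < \<epsilon>" "\<And>e. e \<in> E \<Longrightarrow> 0 \<le> c e" "\<not> satisfied \<epsilon> R c"
  shows "card {e \<in> E. c e = 0} < card {e \<in> E. charge \<epsilon> R c e = 0}"
proof -
  obtain e0 where "e0 \<in> E" "0 < edge_load c (snd R) e0"
    using exists_loaded_edge[OF assms(1,2,4)] .
  from step_properties(3)[OF assms(3) this] obtain e where e: "e \<in> E" "0 < edge_load c (snd R) e"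
    "charge \<epsilon> R c e = 0" using assms(4) by (auto simp: charge_def)
  have "c e \<noteq> 0" using e edge_load_bought[OF e(1)] by auto
  moreover have "charge \<epsilon> R c e' = 0" if "e' \<in> E" "c e' = 0" for e'
    using charge_bounds[where c = c, OF assms(1-3) that(1)] that(2) by simp
  ultimately show ?thesis using e finite_E by (intro psubset_card_mono) auto
qed

text \<open>An unsatisfied request has hit fewer than \<open>(1 - \<epsilon>) f\<close> groups while the optimum hits \<open>f\<close>, so
  of the total load, at most \<open>n\<close>, at least \<open>\<epsilon> f\<close> lies on edges of the optimum.\<close>

lemma charge_cost:
  assumes R: "admissible R" "0 < \<epsilon>" "\<And>e. e \<in> E \<Longrightarrow> 0 \<le> c e"
    and F: "F \<subseteq> E" "\<And>v. v \<in> U \<Longrightarrow> connected_by F r v" "U \<subseteq> V" "real (fst R) \<le> hit_count U (snd R)"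
    and K: "0 \<le> K" "real (\<Sum>g\<leftarrow>snd R. length g) \<le> K * (\<epsilon> * real (fst R))"
  shows "(\<Sum>e\<in>E. c e - charge \<epsilon> R c e) \<le> K * (\<Sum>e\<in>F. c e - charge \<epsilon> R c e)"
proof (cases "satisfied \<epsilon> R c")
  case True
  then show ?thesis by (simp add: charge_def)
next
  case False
  let ?l = "edge_load c (snd R)" and ?\<theta> = "step c (snd R)"
  obtain e0 where "e0 \<in> E" "0 < ?l e0" using exists_loaded_edge[OF R(1,2) False] .
  from step_properties(1)[OF R(3) this] have \<theta>: "0 \<le> ?\<theta>" .
  have "\<epsilon> * real (fst R) \<le> hit_count U (snd R) - hit_count (conn c) (snd R)"
    using False F(4) by (simp add: satisfied_def algebra_simps)
  also have "\<dots> \<le> (\<Sum>e\<in>F. ?l e)" by (rule load_ge_missed_groups[OF F(1-3)])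
  finally have opt: "\<epsilon> * real (fst R) \<le> (\<Sum>e\<in>F. ?l e)" .
  have "(\<Sum>e\<in>E. ?l e) \<le> real (\<Sum>g\<leftarrow>snd R. length g)"
    by (rule total_load_le) (use R(1) in \<open>simp add: admissible_def\<close>)
  also note K(2)
  also have "K * (\<epsilon> * real (fst R)) \<le> K * (\<Sum>e\<in>F. ?l e)" using opt K(1) by (rule mult_left_mono)
  \<comment> \<open>The step length is common to all edges, so an inequality between loads becomes
    one between decreases of residuals.\<close>
  finally have "?\<theta> * (\<Sum>e\<in>E. ?l e) \<le> ?\<theta> * (K * (\<Sum>e\<in>F. ?l e))" using \<theta> by (rule mult_left_mono)
  then show ?thesis using False by (simp add: charge_def sum_distrib_left mult_ac)
qed

section \<open>Sequences of requests\<close>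

definition serve_request ::
  "real \<Rightarrow> nat \<times> nat list list \<Rightarrow> (nat set \<Rightarrow> real) \<Rightarrow> nat set \<Rightarrow> real" where
  "serve_request \<epsilon> R = charge \<epsilon> R ^^ length es"

lemma serve_state_of: "serve \<epsilon> r R (state_of es c) = state_of es (serve_request \<epsilon> R c)"
proof -
  have "fold (\<lambda>_. charge_round \<epsilon> r R) xs (state_of es c) = state_of es ((charge \<epsilon> R ^^ length xs) c)"
    for xs :: state
    by (induction xs arbitrary: c) (simp_all add: charge_round_state_of funpow_swap1)
  then show ?thesis by (simp add: serve_def serve_request_def state_of_def)
qed

lemma serve_all_state_of:
  "serve_all \<epsilon> r \<sigma> (state_of es c) = state_of es (fold (serve_request \<epsilon>) \<sigma> c)"
  unfolding serve_all_def by (induction \<sigma> arbitrary: c) (simp_all add: serve_state_of)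

text \<open>Serves as order and as invariant: \<open>nonneg_below c c\<close> just says that
  \<open>c\<close> is nonnegative on \<open>E\<close>.\<close>

definition nonneg_below :: "(nat set \<Rightarrow> real) \<Rightarrow> (nat set \<Rightarrow> real) \<Rightarrow> bool" where
  "nonneg_below c c' \<longleftrightarrow> (\<forall>e\<in>E. 0 \<le> c' e \<and> c' e \<le> c e)"

lemma nonneg_below_trans: "nonneg_below a b \<Longrightarrow> nonneg_below b c \<Longrightarrow> nonneg_below a c"
  unfolding nonneg_below_def by (meson order_trans)

lemma nonneg_below_charges:
  assumes "admissible R" "0 < \<epsilon>" "nonneg_below c c"
  shows "nonneg_below c ((charge \<epsilon> R ^^ k) c)"
proof (induction k)
  case (Suc k)
  then have "nonneg_below ((charge \<epsilon> R ^^ k) c) (charge \<epsilon> R ((charge \<epsilon> R ^^ k) c))"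
    using charge_bounds[OF assms(1,2)] unfolding nonneg_below_def by blast
  then show ?case using Suc nonneg_below_trans by simp
qed (use assms(3) in simp)

lemma conn_mono: "nonneg_below c c' \<Longrightarrow> conn c \<subseteq> conn c'"
proof -
  assume "nonneg_below c c'"
  then have "{e \<in> E. c e = 0} \<subseteq> {e \<in> E. c' e = 0}" unfolding nonneg_below_def by fastforce
  then show "conn c \<subseteq> conn c'" unfolding conn_def using connected_by_mono by blast
qed

lemma hit_count_mono: "U \<subseteq> U' \<Longrightarrow> hit_count U gs \<le> hit_count U' gs"
  unfolding hit_count_def by (intro sum_list_mono) auto

lemma satisfied_mono: "nonneg_below c c' \<Longrightarrow> satisfied \<epsilon> R c \<Longrightarrow> satisfied \<epsilon> R c'"
  unfolding satisfied_def using hit_count_mono[OF conn_mono] order_trans by blast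

lemma nonneg_below_serve_request:
  "\<lbrakk>admissible R; 0 < \<epsilon>; nonneg_below c c\<rbrakk> \<Longrightarrow> nonneg_below c (serve_request \<epsilon> R c)"
  unfolding serve_request_def by (rule nonneg_below_charges)

text \<open>After \<open>k\<close> rounds the request is satisfied or \<open>k\<close> edges have
  been bought. With \<open>length es\<close> of them the whole tree is bought, \<open>conn\<close>
  contains \<open>V\<close>, and admissibility gives the required hits.\<close>

lemma satisfied_serve_request:
  assumes R: "admissible R" "0 < \<epsilon>" "nonneg_below c c"
  shows "satisfied \<epsilon> R (serve_request \<epsilon> R c)"
proof -
  let ?c = "\<lambda>k. (charge \<epsilon> R ^^ k) c"
  have "satisfied \<epsilon> R (?c k) \<or> k \<le> card {e \<in> E. ?c k e = 0}" for k
  proof (induction k)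
    case (Suc k)
    show ?case
    proof (cases "satisfied \<epsilon> R (?c k)")
      case True
      then have "?c (Suc k) = ?c k" by (simp add: charge_def)
      then show ?thesis using True by simp
    next
      case False
      then show ?thesis
        using charge_buys[OF R(1,2) _ False] nonneg_below_charges[OF R, of k] Suc
        unfolding nonneg_below_def by fastforce
    qed
  qed simp
  moreover have "satisfied \<epsilon> R (?c k)" if "length es \<le> card {e \<in> E. ?c k e = 0}" for k
  proof -
    have "card E \<le> length es"
      using card_image_le[of "set es" edge_of] card_length[of es] by (simp add: es[symmetric] edge_set_def)
    then have "{e \<in> E. ?c k e = 0} = E" using that finite_E by (intro card_seteq) auto
    then have "V \<subseteq> conn (?c k)" using reachable by (auto simp: conn_def)
    then have "hit_count V (snd R) \<le> hit_count (conn (?c k)) (snd R)" by (rule hit_count_mono)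
    moreover have "(1 - \<epsilon>) * real (fst R) \<le> real (fst R)"
      using mult_right_mono[of "1 - \<epsilon>" 1 "real (fst R)"] R(2) by simp
    ultimately show ?thesis using R(1) by (simp add: satisfied_def admissible_def)
  qed
  ultimately show ?thesis unfolding serve_request_def by blast
qed

text \<open>Telescoping over the rounds; \<open>serve_all_cost\<close> repeats it over the requests,
  for a set \<open>U\<close> that hits all of them.\<close>

lemma serve_request_cost:
  assumes R: "admissible R" "0 < \<epsilon>" "nonneg_below c c"
    and F: "F \<subseteq> E" "\<And>v. v \<in> U \<Longrightarrow> connected_by F r v" "U \<subseteq> V" "real (fst R) \<le> hit_count U (snd R)"
    and K: "0 \<le> K" "real (\<Sum>g\<leftarrow>snd R. length g) \<le> K * (\<epsilon> * real (fst R))"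
  shows "(\<Sum>e\<in>E. c e - serve_request \<epsilon> R c e) \<le> K * (\<Sum>e\<in>F. c e - serve_request \<epsilon> R c e)"
proof -
  let ?c = "\<lambda>k. (charge \<epsilon> R ^^ k) c"
  have "(\<Sum>e\<in>E. c e - ?c k e) \<le> K * (\<Sum>e\<in>F. c e - ?c k e)" for k
  proof (induction k)
    case (Suc k)
    have "(\<Sum>e\<in>E. ?c k e - charge \<epsilon> R (?c k) e) \<le> K * (\<Sum>e\<in>F. ?c k e - charge \<epsilon> R (?c k) e)"
      by (rule charge_cost[OF R(1,2) _ F K])
        (use nonneg_below_charges[OF R, of k] in \<open>simp add: nonneg_below_def\<close>)
    then show ?case using Suc by (simp add: sum_subtractf algebra_simps)
  qed simp
  then show ?thesis by (simp add: serve_request_def)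
qed

lemma nonneg_below_serve_all:
  assumes "0 < \<epsilon>" "\<And>R. R \<in> set \<sigma> \<Longrightarrow> admissible R" "nonneg_below c c"
  shows "nonneg_below c (fold (serve_request \<epsilon>) \<sigma> c)"
  using assms(2,3)
proof (induction \<sigma> arbitrary: c)
  case (Cons R \<sigma>)
  then have "nonneg_below c (serve_request \<epsilon> R c)"
    using nonneg_below_serve_request assms(1) by simp
  moreover from this have "nonneg_below (serve_request \<epsilon> R c) (serve_request \<epsilon> R c)"
    by (simp add: nonneg_below_def)
  ultimately show ?case using Cons nonneg_below_trans by (metis fold_simps(2) list.set_intros)
qed simp

text \<open>Satisfied right after its own turn, a request remains so: later residuals only decrease
  and \<open>conn\<close> only grows.\<close>

lemma satisfied_serve_all:
  assumes "0 < \<epsilon>" "\<And>R. R \<in> set \<sigma> \<Longrightarrow> admissible R" "nonneg_below c c" "R \<in> set \<sigma>"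
  shows "satisfied \<epsilon> R (fold (serve_request \<epsilon>) \<sigma> c)"
proof -
  obtain \<sigma>1 \<sigma>2 where \<sigma>: "\<sigma> = \<sigma>1 @ R # \<sigma>2" using assms(4) by (meson split_list)
  define c1 where "c1 = fold (serve_request \<epsilon>) \<sigma>1 c"
  define c2 where "c2 = serve_request \<epsilon> R c1"
  have "nonneg_below c c1" unfolding c1_def
    by (rule nonneg_below_serve_all) (use assms \<sigma> in auto)
  then have c1: "nonneg_below c1 c1" by (simp add: nonneg_below_def)
  have R: "admissible R" using assms by blast
  have "nonneg_below c1 c2" unfolding c2_def using R assms(1) c1 by (rule nonneg_below_serve_request)
  then have "nonneg_below c2 c2" by (simp add: nonneg_below_def)
  then have "nonneg_below c2 (fold (serve_request \<epsilon>) \<sigma>2 c2)"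
    using assms \<sigma> by (intro nonneg_below_serve_all) auto
  moreover have "satisfied \<epsilon> R c2" unfolding c2_def using R assms(1) c1 by (rule satisfied_serve_request)
  ultimately show ?thesis using satisfied_mono by (simp add: \<sigma> c1_def c2_def)
qed

lemma serve_all_cost:
  assumes \<epsilon>: "0 < \<epsilon>" and \<sigma>: "\<And>R. R \<in> set \<sigma> \<Longrightarrow> admissible R" and c: "nonneg_below c c"
    and F: "F \<subseteq> E" "\<And>v. v \<in> U \<Longrightarrow> connected_by F r v" "U \<subseteq> V"
    and hit: "\<And>R. R \<in> set \<sigma> \<Longrightarrow> real (fst R) \<le> hit_count U (snd R)"
    and K: "0 \<le> K" "\<And>R. R \<in> set \<sigma> \<Longrightarrow> real (\<Sum>g\<leftarrow>snd R. length g) \<le> K * (\<epsilon> * real (fst R))"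
  shows "(\<Sum>e\<in>E. c e - fold (serve_request \<epsilon>) \<sigma> c e) \<le> K * (\<Sum>e\<in>F. c e - fold (serve_request \<epsilon>) \<sigma> c e)"
  using \<sigma> c hit K(2)
proof (induction \<sigma> arbitrary: c)
  case (Cons R \<sigma>)
  let ?c = "serve_request \<epsilon> R c"
  have R: "admissible R" using Cons.prems by simp
  have "nonneg_below c ?c" using R \<epsilon> Cons.prems(2) by (rule nonneg_below_serve_request)
  then have "nonneg_below ?c ?c" by (simp add: nonneg_below_def)
  then have "(\<Sum>e\<in>E. ?c e - fold (serve_request \<epsilon>) \<sigma> ?c e)
      \<le> K * (\<Sum>e\<in>F. ?c e - fold (serve_request \<epsilon>) \<sigma> ?c e)"
    using Cons.prems by (intro Cons.IH) auto
  moreover have "(\<Sum>e\<in>E. c e - ?c e) \<le> K * (\<Sum>e\<in>F. c e - ?c e)"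
    using Cons.prems by (intro serve_request_cost[OF R \<epsilon> _ F _ K(1)]) auto
  ultimately show ?case by (simp add: sum_subtractf algebra_simps)
qed simp

text \<open>A bought edge has residual 0 and has thus been charged its full weight, whichever
  requests paid for it.\<close>

lemma bought_weight:
  assumes \<epsilon>: "0 < \<epsilon>" and \<sigma>: "\<And>R. R \<in> set \<sigma> \<Longrightarrow> admissible R" and w: "nonneg_below w w"
    and F: "F \<subseteq> E" "\<And>v. v \<in> U \<Longrightarrow> connected_by F r v" "U \<subseteq> V"
    and hit: "\<And>R. R \<in> set \<sigma> \<Longrightarrow> real (fst R) \<le> hit_count U (snd R)"
    and K: "0 \<le> K" "\<And>R. R \<in> set \<sigma> \<Longrightarrow> real (\<Sum>g\<leftarrow>snd R. length g) \<le> K * (\<epsilon> * real (fst R))"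
  shows "sum w {e \<in> E. fold (serve_request \<epsilon>) \<sigma> w e = 0} \<le> K * sum w F"
proof -
  let ?c = "fold (serve_request \<epsilon>) \<sigma> w"
  have c: "0 \<le> ?c e \<and> ?c e \<le> w e" if "e \<in> E" for e
    using nonneg_below_serve_all[OF \<epsilon> \<sigma> w] that by (simp add: nonneg_below_def)
  have "sum w {e \<in> E. ?c e = 0} = (\<Sum>e\<in>{e \<in> E. ?c e = 0}. w e - ?c e)"
    by (rule sum.cong) auto
  also have "\<dots> \<le> (\<Sum>e\<in>E. w e - ?c e)"
    using c finite_E by (intro sum_mono2) auto
  also have "\<dots> \<le> K * (\<Sum>e\<in>F. w e - ?c e)"
    by (rule serve_all_cost[OF \<epsilon> \<sigma> w F hit K])
  also have "\<dots> \<le> K * sum w F"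
    using c F(1) K(1) by (intro mult_left_mono sum_mono) force+
  finally show ?thesis .
qed

end

section \<open>Instances of the problem\<close>

definition request_lists :: "request \<Rightarrow> nat \<times> nat list list" where
  "request_lists R = (requirement R, map sorted_list_of_set (groups R))"

definition input_of :: "real \<Rightarrow> wgraph \<Rightarrow> nat \<Rightarrow> request list \<Rightarrow> online_input" where
  "input_of \<epsilon> G r \<sigma> = (\<epsilon>, (sorted_list_of_set (verts G),
     state_of (edge_list G) (wt G)), r, map request_lists \<sigma>)"

definition steiner_alg :: "real \<Rightarrow> online_alg" where
  "steiner_alg \<epsilon> G r \<sigma> = edge_set (steiner (input_of \<epsilon> G r \<sigma>))"

lemma encode_map: "(\<And>x. encode (g x) = f x) \<Longrightarrow> encode (map g xs) = enc_list f xs"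
  by (induction xs) (simp_all add: enc_list_def)

lemma encode_input_of: "encode (input_of \<epsilon> G r \<sigma>) = enc_input \<epsilon> G r \<sigma>"
proof -
  have nat: "encode n = enc_nat n" for n :: nat by (simp add: encode_nat_def)
  have set: "encode (sorted_list_of_set S) = enc_set S" for S :: "nat set"
    using encode_map[of "\<lambda>x. x" enc_nat "sorted_list_of_set S"] by (simp add: enc_set_def nat)
  have request: "encode (request_lists R) = enc_request R" for R
    by (simp add: request_lists_def enc_request_def nat encode_map set)
  have "encode (state_of es w) = enc_list (\<lambda>(u, v). VCons (enc_nat u) (VCons (enc_nat v) (VNum (w {u, v})))) es"
    for es w
    unfolding state_of_def
    by (rule encode_map) (auto simp: nat encode_real_def edge_of_def)
  then show ?thesis
    by (simp add: input_of_def enc_input_def enc_graph_def nat set encode_map request)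
      (simp add: encode_real_def)
qed

lemma represents_edge_set: "represents (encode ps) (edge_set ps)"
proof -
  have "encode ps = enc_list (\<lambda>(a, b). VCons (enc_nat a) (enc_nat b)) ps"
    using encode_map[of "\<lambda>x. x" _ ps, OF refl] by (simp add: encode_nat_def encode_prod_def)
  then show ?thesis unfolding represents_def edge_set_def edge_of_def by force
qed

text \<open>Since \<open>\<epsilon>\<close> is part of the encoded input, the program does not
  depend on it. The polynomial bound comes from all values of the input type, whether or not they
  encode trees.\<close>

lemma poly_time_steiner_alg: "poly_time_on_trees \<epsilon> (steiner_alg \<epsilon>)"
proof -
  obtain P C d where "\<And>x. \<exists>t. eval P [encode x] (Call 0 (Var 0)) (encode (steiner x)) t
      \<and> t \<le> C * esize x ^ d"
    using poly_time_program[OF poly_time_steiner] by blast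
  from this[of "input_of \<epsilon> _ _ _"] show ?thesis
    unfolding poly_time_on_trees_def steiner_alg_def esize_def encode_input_of
    using represents_edge_set by metis
qed

lemma sum_list_of_bool: "(\<Sum>x\<leftarrow>xs. of_bool (P x)) = real (card {j. j < length xs \<and> P (xs ! j)})"
proof -
  have "(\<Sum>x\<leftarrow>xs. of_bool (P x)) = real (length (filter P xs))" by (induction xs) auto
  then show ?thesis by (simp add: length_filter_conv_card)
qed

section \<open>Feasibility and competitiveness on a fixed instance\<close>

context
  fixes G :: wgraph and r :: nat and \<sigma> :: "request list"
  assumes inst: "tree_instance G r \<sigma>"
begin

lemma finite_verts: "finite (verts G)"
  using inst by (simp add: tree_instance_def weighted_tree_def is_tree_def is_graph_def)

lemma rooted_tree_instance: "rooted_tree (verts G) (edges G) r (edge_list G)"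
proof
  have graph: "is_graph (verts G) (edges G)"
    using inst by (simp add: tree_instance_def weighted_tree_def is_tree_def)
  show "is_tree (verts G) (edges G)" "r \<in> verts G"
    using inst by (simp_all add: tree_instance_def weighted_tree_def)
  show "fst p < snd p" if "p \<in> set (edge_list G)" for p
    using that by (auto simp: edge_list_def)
  show "edge_set (edge_list G) = edges G"
  proof (intro equalityI subsetI)
    fix e assume "e \<in> edge_set (edge_list G)"
    then show "e \<in> edges G" by (auto simp: edge_set_def edge_of_def edge_list_def)
  next
    fix e assume e: "e \<in> edges G"
    then obtain a b where ab: "e = {a, b}" "a \<noteq> b" "a \<in> verts G" "b \<in> verts G"
      using graph unfolding is_graph_def by (metis card_2_iff insert_subset)
    define p where "p = (min a b, max a b)"
    have "edge_of p = e" using ab by (auto simp: p_def edge_of_def min_def max_def)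
    moreover have "p \<in> set (edge_list G)"
      using ab e finite_verts by (auto simp: p_def edge_list_def min_def max_def insert_commute)
    ultimately show "e \<in> edge_set (edge_list G)" by (auto simp: edge_set_def)
  qed
qed

interpretation rooted_tree "verts G" "edges G" r "edge_list G"
  by (rule rooted_tree_instance)

lemma groups_subset: "R \<in> set \<sigma> \<Longrightarrow> g \<in> set (groups R) \<Longrightarrow> g \<subseteq> verts G \<and> finite g"
  using inst finite_verts by (meson finite_subset tree_instance_def valid_request_def)

lemma hit_count_request:
  assumes "R \<in> set \<sigma>" shows "hit_count U (snd (request_lists R)) = real (groups_hit U R)"
proof -
  have "hit_count U (snd (request_lists R)) = (\<Sum>g\<leftarrow>groups R. of_bool (g \<inter> U \<noteq> {}))"
    unfolding hit_count_def request_lists_def using groups_subset[OF assms]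
    by (auto intro!: arg_cong[of _ _ sum_list])
  then show ?thesis by (simp add: sum_list_of_bool groups_hit_def)
qed

lemma incidences_request:
  assumes "R \<in> set \<sigma>" shows "(\<Sum>g\<leftarrow>snd (request_lists R). length g) = n_incidences R"
proof -
  have "(\<Sum>g\<leftarrow>snd (request_lists R). length g) = (\<Sum>g\<leftarrow>groups R. card g)"
    using groups_subset[OF assms] by (auto simp: request_lists_def intro!: arg_cong[of _ _ sum_list])
  then show ?thesis by (simp add: n_incidences_def sum_list_sum_nth atLeast0LessThan)
qed

lemma admissible_request:
  assumes "R \<in> set \<sigma>" shows "admissible (request_lists R)"
proof -
  have "set g \<subseteq> verts G" if g: "g \<in> set (snd (request_lists R))" for g
  proof -
    obtain g' where "g' \<in> set (groups R)" "g = sorted_list_of_set g'"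
      using g by (auto simp: request_lists_def)
    then show ?thesis using groups_subset[OF assms] by simp
  qed
  moreover have "groups_hit (verts G) R = card {j. j < length (groups R) \<and> groups R ! j \<noteq> {}}"
    unfolding groups_hit_def using groups_subset[OF assms]
    by (intro arg_cong[of _ _ card] Collect_cong) (metis Int_absorb2 nth_mem)
  moreover have "requirement R \<le> card {j. j < length (groups R) \<and> groups R ! j \<noteq> {}}"
    using inst assms by (simp add: tree_instance_def valid_request_def)
  ultimately show ?thesis
    by (simp add: admissible_def hit_count_request[OF assms]) (simp add: request_lists_def)
qed

lemma admissible_prefix:
  assumes "R \<in> set (map request_lists (take n \<sigma>))" shows "admissible R"
  using assms admissible_request in_set_takeD[of _ n \<sigma>] by auto

lemma wt_nonneg: "nonneg_below (wt G) (wt G)"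
  using inst by (force simp: nonneg_below_def tree_instance_def weighted_tree_def)

definition residual :: "real \<Rightarrow> request list \<Rightarrow> nat set \<Rightarrow> real" where
  "residual \<epsilon> \<rho> = fold (serve_request \<epsilon>) (map request_lists \<rho>) (wt G)"

lemma steiner_alg_eq: "steiner_alg \<epsilon> G r \<rho> = {e \<in> edges G. residual \<epsilon> \<rho> e = 0}"
  by (simp add: steiner_alg_def steiner_def input_of_def serve_all_state_of edge_set_bought
      residual_def)

text \<open>Replaying a longer prefix repeats the earlier computation and then serves one more
  request; a nonnegative residual that only decreases stays 0 once it is 0.\<close>

lemma online_feasible_steiner_alg:
  assumes "0 < \<epsilon>" shows "online_feasible (steiner_alg \<epsilon>) G r \<sigma>"
proof -
  have "steiner_alg \<epsilon> G r (take (Suc t) \<sigma>) \<subseteq> steiner_alg \<epsilon> G r (take (Suc (Suc t)) \<sigma>)"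
    if t: "Suc t < length \<sigma>" for t
  proof -
    let ?c = "residual \<epsilon> (take (Suc t) \<sigma>)" and ?c' = "residual \<epsilon> (take (Suc (Suc t)) \<sigma>)"
    have "nonneg_below (wt G) ?c" unfolding residual_def
      by (rule nonneg_below_serve_all[OF assms _ wt_nonneg])
        (rule admissible_prefix)
    then have "nonneg_below ?c ?c" by (simp add: nonneg_below_def)
    moreover have "?c' = serve_request \<epsilon> (request_lists (\<sigma> ! Suc t)) ?c"
      using t by (simp add: residual_def take_Suc_conv_app_nth)
    ultimately have "nonneg_below ?c ?c'"
      using nonneg_below_serve_request admissible_request t assms by simp
    then show ?thesis unfolding steiner_alg_eq nonneg_below_def by fastforce
  qed
  then show ?thesis by (simp add: online_feasible_def output_at_def steiner_alg_eq)
qed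

lemma connection_competitive_steiner_alg:
  assumes "0 < \<epsilon>" shows "connection_competitive (1 - \<epsilon>) (steiner_alg \<epsilon>) G r \<sigma>"
  unfolding connection_competitive_def
proof (intro allI impI)
  fix t i assume t: "t < length \<sigma>" "i \<le> t"
  have mem: "\<sigma> ! i \<in> set (take (Suc t) \<sigma>)" using t by (auto simp: in_set_conv_nth intro!: exI[of _ i])
  have "satisfied \<epsilon> (request_lists (\<sigma> ! i)) (residual \<epsilon> (take (Suc t) \<sigma>))"
    unfolding residual_def
    by (rule satisfied_serve_all[OF assms _ wt_nonneg])
      (use mem admissible_prefix in auto)
  then have "(1 - \<epsilon>) * real (requirement (\<sigma> ! i))
      \<le> real (groups_hit (conn (residual \<epsilon> (take (Suc t) \<sigma>))) (\<sigma> ! i))"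
    using t by (simp add: satisfied_def hit_count_request) (simp add: request_lists_def)
  then show "(1 - \<epsilon>) * real (requirement (\<sigma> ! i))
      \<le> real (groups_hit {v. connected_by (output_at (steiner_alg \<epsilon>) G r \<sigma> t) r v} (\<sigma> ! i))"
    by (simp add: output_at_def steiner_alg_eq conn_def)
qed

text \<open>\<open>Min\<close> is meaningful because there are finitely many edge sets and the whole
  tree is a candidate, by validity of the requests.\<close>

lemma OPT_attained:
  assumes t: "t < length \<sigma>"
  obtains U F where "U \<subseteq> verts G" "F \<subseteq> edges G" "is_tree U F" "r \<in> U"
    "\<forall>i\<le>t. requirement (\<sigma> ! i) \<le> groups_hit U (\<sigma> ! i)" "OPT G r \<sigma> t = weight G F"
proof -
  define W where "W = {weight G F | U F. U \<subseteq> verts G \<and> F \<subseteq> edges G \<and> is_tree U F \<and> r \<in> U \<and>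
     (\<forall>i\<le>t. requirement (\<sigma> ! i) \<le> groups_hit U (\<sigma> ! i))}"
  have "W \<subseteq> weight G ` Pow (edges G)" by (auto simp: W_def)
  then have "finite W" using finite_E finite_subset by blast
  moreover have "requirement (\<sigma> ! i) \<le> groups_hit (verts G) (\<sigma> ! i)" if "i \<le> t" for i
  proof -
    have "\<sigma> ! i \<in> set \<sigma>" using that t by simp
    then show ?thesis using admissible_request hit_count_request
      by (metis admissible_def fst_conv of_nat_le_iff request_lists_def)
  qed
  then have "weight G (edges G) \<in> W" using tree root by (auto simp: W_def)
  ultimately have "Min W \<in> W" by (intro Min_in) auto
  then show ?thesis using that by (auto simp: W_def OPT_def)
qed

lemma cost_competitive_steiner_alg:
  assumes \<epsilon>: "0 < \<epsilon>"
  shows "cost_competitive (1 / \<epsilon> * max_ratio n_incidences \<sigma>) (steiner_alg \<epsilon>) G r \<sigma>"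
  unfolding cost_competitive_def
proof (intro allI impI)
  fix t assume t: "t < length \<sigma>"
  obtain U F where U: "U \<subseteq> verts G" "F \<subseteq> edges G" "is_tree U F" "r \<in> U"
    and hit: "\<forall>i\<le>t. requirement (\<sigma> ! i) \<le> groups_hit U (\<sigma> ! i)"
    and OPT: "OPT G r \<sigma> t = weight G F"
    using OPT_attained[OF t] by metis
  let ?\<rho> = "take (Suc t) \<sigma>"
  have ratio: "real (n_incidences R) / real (requirement R) \<le> max_ratio n_incidences \<sigma>"
    if "R \<in> set \<sigma>" for R
    unfolding max_ratio_def using that by (intro Max_ge) auto
  have "\<sigma> ! t \<in> set \<sigma>" using t by simp
  from ratio[OF this] have nonneg: "0 \<le> max_ratio n_incidences \<sigma>"
    by (rule order_trans[rotated]) simp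
  have "sum (wt G) {e \<in> edges G. residual \<epsilon> ?\<rho> e = 0}
      \<le> (1 / \<epsilon> * max_ratio n_incidences \<sigma>) * sum (wt G) F"
    unfolding residual_def
  proof (rule bought_weight[OF \<epsilon> _ wt_nonneg U(2) _ U(1)])
    show "0 \<le> 1 / \<epsilon> * max_ratio n_incidences \<sigma>" using \<epsilon> nonneg by simp
    show "connected_by F r v" if "v \<in> U" for v using U(3,4) that by (simp add: is_tree_def)
  next
    fix R' assume "R' \<in> set (map request_lists ?\<rho>)"
    then obtain R where R: "R' = request_lists R" "R \<in> set ?\<rho>" by auto
    then have mem: "R \<in> set \<sigma>" by (auto dest: in_set_takeD)
    show "admissible R'" using R(1) mem admissible_request by simp
    have "requirement R \<le> groups_hit U R" using R(2) hit t by (auto simp: in_set_conv_nth)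
    then show "real (fst R') \<le> hit_count U (snd R')"
      unfolding R(1) hit_count_request[OF mem] by (simp add: request_lists_def)
    have "1 \<le> requirement R" using inst mem by (simp add: tree_instance_def valid_request_def)
    then have "real (n_incidences R) \<le> max_ratio n_incidences \<sigma> * real (requirement R)"
      using ratio[OF mem] by (simp add: divide_le_eq)
    \<comment> \<open>The factor \<open>1 / \<epsilon>\<close> cancels the share
      \<open>\<epsilon> f\<close> that the optimum is guaranteed to pay, leaving the ratio times
      \<open>f\<close>.\<close>
    then show "real (\<Sum>g\<leftarrow>snd R'. length g)
        \<le> (1 / \<epsilon> * max_ratio n_incidences \<sigma>) * (\<epsilon> * real (fst R'))"
      unfolding R(1) incidences_request[OF mem] using \<epsilon> by (simp add: request_lists_def)
  qed
  then show "weight G (output_at (steiner_alg \<epsilon>) G r \<sigma> t)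
      \<le> 1 / \<epsilon> * max_ratio n_incidences \<sigma> * OPT G r \<sigma> t"
    by (simp add: OPT weight_def output_at_def steiner_alg_eq)
qed

lemma n_verts_disjoint:
  assumes "R \<in> set \<sigma>" "disjoint_groups R" shows "n_verts R = n_incidences R"
proof -
  have "{v. \<exists>g\<in>set (groups R). v \<in> g} = (\<Union>j<length (groups R). groups R ! j)"
    by (auto simp: set_conv_nth)
  then show ?thesis
    using assms groups_subset[OF assms(1)]
    unfolding n_verts_def n_incidences_def disjoint_groups_def disjoint_family_on_def
    by (simp add: card_UN_disjoint)
qed

end

theorem theorem12:
  fixes \<epsilon> :: real
  assumes "\<epsilon> > 0"
  shows "\<exists>A :: online_alg. poly_time_on_trees \<epsilon> A \<and>
    (\<forall>G r \<sigma>. tree_instance G r \<sigma> \<longrightarrow>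
       online_feasible A G r \<sigma> \<and>
       connection_competitive (1 - \<epsilon>) A G r \<sigma> \<and>
       ((\<forall>R\<in>set \<sigma>. disjoint_groups R) \<longrightarrow>
          cost_competitive (1 / \<epsilon> * max_ratio n_verts \<sigma>) A G r \<sigma>) \<and>
       cost_competitive (1 / \<epsilon> * max_ratio n_incidences \<sigma>) A G r \<sigma>)"
proof (intro exI[of _ "steiner_alg \<epsilon>"] conjI allI impI)
  fix G r \<sigma>
  assume inst: "tree_instance G r \<sigma>"
  note cost = cost_competitive_steiner_alg[OF inst assms]
  then show "cost_competitive (1 / \<epsilon> * max_ratio n_incidences \<sigma>) (steiner_alg \<epsilon>) G r \<sigma>" .
  assume "\<forall>R\<in>set \<sigma>. disjoint_groups R"
  then have "max_ratio n_verts \<sigma> = max_ratio n_incidences \<sigma>"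
    unfolding max_ratio_def using n_verts_disjoint[OF inst]
    by (intro arg_cong[of _ _ Max] image_cong) auto
  then show "cost_competitive (1 / \<epsilon> * max_ratio n_verts \<sigma>) (steiner_alg \<epsilon>) G r \<sigma>"
    using cost by simp
qed (use assms in \<open>simp_all add: poly_time_steiner_alg online_feasible_steiner_alg
    connection_competitive_steiner_alg\<close>)

end
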